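(* Let $\lambda_1\neq\lambda_2$ be positive, $\tau\in(0,1)$, and let $\Delta_n\to0$, $n\Delta_n\to\infty$ as $n\to\infty$. Then the estimator $\hat\tau=\hat k_0/n$ of $\tau$ satisfies $$|\hat\tau-\tau|=(n\Delta_n)^{-1/2}(\gamma_2-\gamma_1)^{-1}\,O_p\!\left(\sqrt{\log n}\right).$$
   Context: Fix $v>0$. For each $n\ge 2$ let $\Delta_n>0$, $T=n\Delta_n$, $t_i=i\Delta_n$ for $i=0,\dots,n$. The telegraph process is $X(t)=V(0)\int_0^t(-1)^{N(s)}\,ds$, $0\le t\le T$, where $N$ is an inhomogeneous Poisson process with intensity $\lambda(t)=\lambda_1\mathbf 1_{\{t\le\theta_0\}}+\lambda_2\mathbf 1_{\{t>\theta_0\}}$, and $V(0)$ is independent of $N$ and takes the values $+v,-v$ with probability $1/2$ each. The change occurs at the observation time $\theta_0=k_0\Delta_n$ with $k_0=[n\tau]$ (integer part). Only $X_i=X(t_i)$, $i=0,\dots,n$ (with $X_0=0$) are observed. Put $\eta_i=X_i-X_{i-1}$ and $Y_i=\mathbf 1_{\{|\eta_i|<v\Delta_n\}}/\Delta_n$, $i=1,\dots,n$. Let $\gamma_m=\frac{1-e^{-\lambda_m\Delta_n}}{\Delta_n}$, $m=1,2$, which is the mean of $Y_i$ for $i\le k_0$ ($m=1$) and for $i>k_0$ ($m=2$). For $1\le k\le n-1$ let $\bar Y_k=\frac1k\sum_{i=1}^kY_i$, $\bar Y_{n-k}=\frac1{n-k}\sum_{i=k+1}^nY_i$ (the mean of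 the last $n-k$ variables), and $$V_k=\sqrt{\frac{k(n-k)}{n^2}}\,(\bar Y_{n-k}-\bar Y_k).$$ The least squares change point estimator $\hat k_0$ is $$\hat k_0=\arg\min_{1\le k\le n-1}\Big\{\sum_{i=1}^k(Y_i-\bar Y_k)^2+\sum_{i=k+1}^n(Y_i-\bar Y_{n-k})^2\Big\}=\arg\max_{1\le k\le n-1}V_k^2 .$$ *)

theory Defs
  imports "HOL-Probability.Probability"
begin

definition step_intensity :: "real \<Rightarrow> real \<Rightarrow> real \<Rightarrow> real \<Rightarrow> real" where
  "step_intensity lam1 lam2 theta t = (if t \<le> theta then lam1 else lam2)"

text \<open>Increments use truncated subtraction on \<^typ>\<open>nat\<close>; this is harmless because the
  paths are nondecreasing.\<close>

definition inhom_poisson_process ::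
    "'a measure \<Rightarrow> (real \<Rightarrow> real) \<Rightarrow> real \<Rightarrow> (real \<Rightarrow> 'a \<Rightarrow> nat) \<Rightarrow> bool" where
  "inhom_poisson_process M lam T N \<longleftrightarrow>
     prob_space M \<and>
     (\<forall>t\<in>{0..T}. N t \<in> measurable M (count_space UNIV)) \<and>
     (\<forall>\<omega>\<in>space M. N 0 \<omega> = 0 \<and> mono_on {0..T} (\<lambda>t. N t \<omega>) \<and>
        (\<forall>t\<in>{0..<T}. continuous (at_right t) (\<lambda>s. N s \<omega>))) \<and>
     (\<forall>m u. (\<forall>i\<le>m. u i \<in> {0..T}) \<and> mono_on {..m} u \<longrightarrow>
        prob_space.indep_vars M (\<lambda>_. count_space UNIV)
          (\<lambda>i \<omega>. N (u (Suc i)) \<omega> - N (u i) \<omega>) {..<m::nat}) \<and>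
     (\<forall>s t j. 0 \<le> s \<and> s \<le> t \<and> t \<le> T \<longrightarrow>
        measure M {\<omega>\<in>space M. N t \<omega> - N s \<omega> = j} =
          exp (- integral {s..t} lam) * integral {s..t} lam ^ j / fact j)"

text \<open>Independence of \<open>V0\<close> and the whole process \<open>N\<close> is independence of \<open>V0\<close> and the random
  function \<open>t \<mapsto> N t\<close> on \<open>[0, T]\<close>, with the product sigma-algebra on path space.\<close>

definition telegraph_driver ::
    "'a measure \<Rightarrow> real \<Rightarrow> (real \<Rightarrow> real) \<Rightarrow> real \<Rightarrow> ('a \<Rightarrow> real) \<Rightarrow> (real \<Rightarrow> 'a \<Rightarrow> nat) \<Rightarrow> bool" where
  "telegraph_driver M v lam T V0 N \<longleftrightarrow>
     inhom_poisson_process M lam T N \<and>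
     V0 \<in> borel_measurable M \<and>
     measure M {\<omega>\<in>space M. V0 \<omega> = v} = 1/2 \<and>
     measure M {\<omega>\<in>space M. V0 \<omega> = - v} = 1/2 \<and>
     prob_space.indep_set M
       (sets (vimage_algebra (space M) V0 borel))
       (sets (vimage_algebra (space M) (\<lambda>\<omega>. \<lambda>t\<in>{0..T}. N t \<omega>)
         (PiM {0..T} (\<lambda>_. count_space UNIV))))"

definition telegraph :: "('a \<Rightarrow> real) \<Rightarrow> (real \<Rightarrow> 'a \<Rightarrow> nat) \<Rightarrow> real \<Rightarrow> 'a \<Rightarrow> real" where
  "telegraph V0 N t \<omega> = V0 \<omega> * integral {0..t} (\<lambda>s. (-1) ^ N s \<omega>)"

text \<open>Here \<open>x\<close> is a path observed at the times \<open>i * \<Delta>\<close>; the definition is meant for \<open>i \<ge> 1\<close>.\<close>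

definition switch_obs :: "real \<Rightarrow> real \<Rightarrow> (real \<Rightarrow> real) \<Rightarrow> nat \<Rightarrow> real" where
  "switch_obs v \<Delta> x i =
     of_bool (\<bar>x (real i * \<Delta>) - x (real (i - 1) * \<Delta>)\<bar> < v * \<Delta>) / \<Delta>"

definition head_mean :: "(nat \<Rightarrow> real) \<Rightarrow> nat \<Rightarrow> real" where
  "head_mean y k = (\<Sum>i=1..k. y i) / real k"

definition tail_mean :: "nat \<Rightarrow> (nat \<Rightarrow> real) \<Rightarrow> nat \<Rightarrow> real" where
  "tail_mean n y k = (\<Sum>i=k+1..n. y i) / real (n - k)"

definition ls_criterion :: "nat \<Rightarrow> (nat \<Rightarrow> real) \<Rightarrow> nat \<Rightarrow> real" where
  "ls_criterion n y k =
     (\<Sum>i=1..k. (y i - head_mean y k)\<^sup>2) + (\<Sum>i=k+1..n. (y i - tail_mean n y k)\<^sup>2)"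

text \<open>The minimiser need not be unique, so this is a predicate: any measurable selection of a
  minimiser is a least squares change point estimator.\<close>

definition ls_change_point_estimator ::
    "'a measure \<Rightarrow> nat \<Rightarrow> (nat \<Rightarrow> 'a \<Rightarrow> real) \<Rightarrow> ('a \<Rightarrow> nat) \<Rightarrow> bool" where
  "ls_change_point_estimator M n Y khat \<longleftrightarrow>
     khat \<in> measurable M (count_space UNIV) \<and>
     (\<forall>\<omega>\<in>space M. is_arg_min (ls_criterion n (\<lambda>i. Y i \<omega>)) (\<lambda>k. k \<in> {1..n-1}) (khat \<omega>))"

definition switch_rate :: "real \<Rightarrow> real \<Rightarrow> real" where
  "switch_rate lam \<Delta> = (1 - exp (- lam * \<Delta>)) / \<Delta>"

text \<open>\<open>Z n = O\<^sub>p(a n)\<close>, where \<open>Z n\<close> may live on a probability space depending on \<open>n\<close>.\<close>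

definition bigO_prob :: "(nat \<Rightarrow> 'a measure) \<Rightarrow> (nat \<Rightarrow> 'a \<Rightarrow> real) \<Rightarrow> (nat \<Rightarrow> real) \<Rightarrow> bool" where
  "bigO_prob M Z a \<longleftrightarrow>
     (\<forall>n. Z n \<in> borel_measurable (M n)) \<and>
     (\<forall>\<epsilon>>0. \<exists>C>0. \<forall>\<^sub>F n in sequentially.
        measure (M n) {\<omega>\<in>space (M n). \<bar>Z n \<omega>\<bar> > C * a n} < \<epsilon>)"

end

theory Submission imports Defs begin

text \<open>Write \<open>Y\<^sub>i\<close> for the observations and \<open>\<gamma>\<^sub>1, \<gamma>\<^sub>2\<close> for their means before and after the change.
  Splitting the total sum of squares shows that a least squares change point maximises the
  absolute value of the weighted difference \<open>V\<^sub>k\<close> of the two sample means (\<open>cusum\<close> below), and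
  \<open>V\<^sub>k\<close> is linear in the data.  For data equal to their means, \<open>|V\<^sub>k|\<close> has a sharp
  peak at \<open>k\<^sub>0\<close>: on both sides it drops by at least a constant times
  \<open>|\<gamma>\<^sub>2 - \<gamma>\<^sub>1| |k - k\<^sub>0| / n\<close> (\<open>cusum_step_mean_peak\<close>).  The maximiser of the noisy
  criterion can therefore be no further away than twice the largest contribution of the noise allows
  (\<open>ls_argmin_error_bound\<close>).

  That contribution is controlled by the partial sums of the centred observations, taken
  from the left and from the right end, each divided by the square root of its length.  The
  Hajek-Renyi inequality (\<open>hajek_renyi\<close>) bounds the maximum of such normalised sums: since
  \<open>\<Sum>\<^sub>k\<^sub>\<le>\<^sub>n 1/k \<le> 1 + ln n\<close>, it has order \<open>sqrt (\<sigma>\<^sup>2 ln n)\<close> in probability, which is where the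
  logarithm comes from.  Here \<open>\<sigma>\<^sup>2\<close> is of order \<open>1/\<Delta>\<close>, because \<open>\<Delta> Y\<^sub>i\<close> is an indicator of
  probability at most \<open>max \<lambda>\<^sub>1 \<lambda>\<^sub>2 \<Delta>\<close>.  Dividing by the \<open>sqrt n\<close> of the cusum weights gives the rate
  \<open>sqrt (ln n / (n \<Delta>))\<close>; rounding \<open>n \<tau>\<close> to \<open>k\<^sub>0\<close> costs \<open>1/n\<close>, which is smaller.

  It remains to see that the \<open>Y\<^sub>i\<close> are independent with these means.  Almost surely
  \<open>Y\<^sub>i \<noteq> 0\<close> iff the Poisson process grows over the \<open>i\<close>-th interval
  (\<open>telegraph_switch_obs_AE\<close>).  This needs an argument, since the paths
  are only known to be monotone and right continuous: two simultaneous events would leave the velocity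
  unchanged, and an event at the right end point of the interval would not shorten the increment.
  Both are excluded almost surely by cutting the interval into ever finer pieces
  (\<open>poisson_unit_jumps_AE\<close>).\<close>

section \<open>Least squares as maximisation of a weighted mean difference\<close>

text \<open>Decomposition of the total sum of squares into a part within the two segments, which is the
  criterion, a part between the segments, and a part that does not depend on the split.\<close>

lemma ls_criterion_eq_sum_squares:
  assumes "1 \<le> k" "k < n"
  shows "ls_criterion n y k = (\<Sum>i=1..n. (y i)\<^sup>2) - (\<Sum>i=1..n. y i)\<^sup>2 / real n
           - real k * real (n - k) / real n * (tail_mean n y k - head_mean y k)\<^sup>2"
proof -
  have split: "(\<Sum>i=1..n. f i) = (\<Sum>i=1..k. f i) + (\<Sum>i=k+1..n. f i)" for f :: "nat \<Rightarrow> real"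
    using assms sum.ub_add_nat[of 1 k f "n - k"] by simp
  have dev: "(\<Sum>i\<in>A. (y i - c)\<^sup>2) = (\<Sum>i\<in>A. (y i)\<^sup>2) - 2 * c * (\<Sum>i\<in>A. y i) + real (card A) * c\<^sup>2"
    for A and c :: real
    by (simp add: power2_diff sum.distrib sum_subtractf sum_distrib_left sum_distrib_right algebra_simps)
  define h t where "h = head_mean y k" and "t = tail_mean n y k"
  have h: "(\<Sum>i=1..k. y i) = real k * h" and t: "(\<Sum>i=k+1..n. y i) = real (n - k) * t"
    using assms by (simp_all add: h_def t_def head_mean_def tail_mean_def)
  have n: "real n = real k + real (n - k)" "real k + real (n - k) > 0"
    using assms by auto
  have "ls_criterion n y k = (\<Sum>i=1..n. (y i)\<^sup>2) - real k * h\<^sup>2 - real (n - k) * t\<^sup>2"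
    unfolding ls_criterion_def dev h_def[symmetric] t_def[symmetric] h t split[of "\<lambda>i. (y i)\<^sup>2"]
    using assms by (simp add: power2_eq_square algebra_simps)
  also have "real k * h\<^sup>2 + real (n - k) * t\<^sup>2 =
      (real k * h + real (n - k) * t)\<^sup>2 / real n + real k * real (n - k) / real n * (t - h)\<^sup>2"
    unfolding n(1) using n(2) by (simp add: divide_simps) (simp add: power2_eq_square algebra_simps)
  then have "real k * h\<^sup>2 + real (n - k) * t\<^sup>2 =
      (\<Sum>i=1..n. y i)\<^sup>2 / real n + real k * real (n - k) / real n * (t - h)\<^sup>2"
    by (simp only: split[of y] h t)
  ultimately show ?thesis unfolding h_def t_def by linarith
qed

text \<open>The statistic \<open>V\<^sub>k\<close>, i.e. the signed square root of the part between the segments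
  divided by \<open>n\<close>.  The square root makes it linear in the data, so signal and noise can be
  treated separately.\<close>

definition cusum :: "nat \<Rightarrow> (nat \<Rightarrow> real) \<Rightarrow> nat \<Rightarrow> real" where
  "cusum n y k = sqrt (real k * real (n - k)) / real n * (tail_mean n y k - head_mean y k)"

lemma ls_argmin_maximises_cusum:
  assumes "is_arg_min (ls_criterion n y) (\<lambda>k. k \<in> {1..n-1}) k" "j \<in> {1..n-1}"
  shows "\<bar>cusum n y j\<bar> \<le> \<bar>cusum n y k\<bar>"
proof -
  have k: "1 \<le> k" "k < n" and j: "1 \<le> j" "j < n"
    using assms by (auto simp: is_arg_min_def)
  have sq: "(cusum n y i)\<^sup>2 = (real i * real (n - i) / real n * (tail_mean n y i - head_mean y i)\<^sup>2) / real n" for i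
    by (simp add: cusum_def power_mult_distrib power_divide power2_eq_square[of "real n"])
  have "ls_criterion n y k \<le> ls_criterion n y j"
    using assms by (auto simp: is_arg_min_def not_less)
  then have "real j * real (n - j) / real n * (tail_mean n y j - head_mean y j)\<^sup>2
      \<le> real k * real (n - k) / real n * (tail_mean n y k - head_mean y k)\<^sup>2"
    using ls_criterion_eq_sum_squares[OF k] ls_criterion_eq_sum_squares[OF j] by simp
  then have "(cusum n y j)\<^sup>2 \<le> (cusum n y k)\<^sup>2"
    unfolding sq by (rule divide_right_mono) simp
  then show ?thesis by (simp add: abs_le_square_iff)
qed

lemma cusum_add: "cusum n (\<lambda>i. x i + y i) k = cusum n x k + cusum n y k"
  by (simp add: cusum_def tail_mean_def head_mean_def sum.distrib add_divide_distrib algebra_simps)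

text \<open>The weight in \<open>cusum\<close> turns each sample mean into a partial sum over the square root of its
  length, times the root of the other length over \<open>n\<close>, which is at most \<open>1 / sqrt n\<close>.  So the bound is uniform
  in \<open>k\<close>, including splits close to the end points.\<close>

lemma cusum_noise_bound:
  assumes k: "1 \<le> k" "k < n"
    and head: "\<bar>\<Sum>i=1..k. e i\<bar> \<le> a * sqrt (real k)"
    and tail: "\<bar>\<Sum>i=k+1..n. e i\<bar> \<le> a * sqrt (real (n - k))"
  shows "\<bar>cusum n e k\<bar> \<le> 2 * a / sqrt (real n)"
proof -
  define p q where "p = sqrt (real k)" and "q = sqrt (real (n - k))"
  have pq: "p > 0" "q > 0" "real k = p * p" "real (n - k) = q * q"
    using k by (auto simp: p_def q_def)
  have n: "real n = sqrt (real n) * sqrt (real n)" "sqrt (real n) > 0" using k by auto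
  have le: "p \<le> sqrt (real n)" "q \<le> sqrt (real n)" using k by (auto simp: p_def q_def)
  have a: "a \<ge> 0"
    using head pq(1) by (smt (verit) p_def mult_neg_pos)
  have "cusum n e k = (p * ((\<Sum>i=k+1..n. e i) / q) - q * ((\<Sum>i=1..k. e i) / p)) / real n"
  proof -
    have root: "sqrt (real k * real (n - k)) = p * q" by (simp add: p_def q_def real_sqrt_mult)
    have "real n > 0" using k by simp
    then show ?thesis
      unfolding cusum_def tail_mean_def head_mean_def root unfolding pq(3,4)
      using pq(1,2) by (simp add: field_simps)
  qed
  also have "\<bar>\<dots>\<bar> \<le> (p * a + q * a) / real n"
  proof -
    have "\<bar>(\<Sum>i=k+1..n. e i) / q\<bar> \<le> a" "\<bar>(\<Sum>i=1..k. e i) / p\<bar> \<le> a"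
      using head tail pq(1,2) by (simp_all add: p_def[symmetric] q_def[symmetric] pos_divide_le_eq)
    then have "\<bar>p * ((\<Sum>i=k+1..n. e i) / q)\<bar> \<le> p * a" "\<bar>q * ((\<Sum>i=1..k. e i) / p)\<bar> \<le> q * a"
      using pq(1,2) by (simp_all only: abs_mult abs_of_pos mult_left_mono less_imp_le)
    then have "\<bar>p * ((\<Sum>i=k+1..n. e i) / q) - q * ((\<Sum>i=1..k. e i) / p)\<bar> \<le> p * a + q * a"
      by linarith
    then show ?thesis by (simp add: divide_right_mono)
  qed
  also have "\<dots> \<le> (sqrt (real n) * a + sqrt (real n) * a) / real n"
    using le a by (intro divide_right_mono add_mono mult_right_mono) auto
  also have "\<dots> = 2 * a / sqrt (real n)"
    by (subst n(1)) (use n(2) in \<open>simp add: field_simps\<close>)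
  finally show ?thesis .
qed

definition step_mean :: "nat \<Rightarrow> real \<Rightarrow> real \<Rightarrow> nat \<Rightarrow> real" where
  "step_mean k0 m1 m2 i = (if i \<le> k0 then m1 else m2)"

lemma cusum_step_mean_left:
  assumes "1 \<le> k" "k \<le> k0" "k0 < n"
  shows "cusum n (step_mean k0 m1 m2) k =
    (m2 - m1) * ((1 - real k0 / real n) * sqrt (real k / real (n - k)))"
proof -
  have "(\<Sum>i=1..k. step_mean k0 m1 m2 i) = (\<Sum>i=1..k. m1)"
    using assms by (intro sum.cong) (auto simp: step_mean_def)
  then have h: "head_mean (step_mean k0 m1 m2) k = m1"
    using assms by (simp add: head_mean_def)
  have "(\<Sum>i=k+1..n. step_mean k0 m1 m2 i) = 
      (\<Sum>i=k+1..k0. step_mean k0 m1 m2 i) + (\<Sum>i=k0+1..n. step_mean k0 m1 m2 i)"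
    using assms sum.ub_add_nat[of "k+1" k0 "step_mean k0 m1 m2" "n - k0"] by simp
  also have "(\<Sum>i=k+1..k0. step_mean k0 m1 m2 i) = (\<Sum>i=k+1..k0. m1)"
    by (intro sum.cong) (auto simp: step_mean_def)
  also have "(\<Sum>i=k0+1..n. step_mean k0 m1 m2 i) = (\<Sum>i=k0+1..n. m2)"
    by (intro sum.cong) (auto simp: step_mean_def)
  finally have t: "(\<Sum>i=k+1..n. step_mean k0 m1 m2 i) = real (k0 - k) * m1 + real (n - k0) * m2"
    by simp
  define p q where "p = sqrt (real k)" and "q = sqrt (real (n - k))"
  have q: "q > 0" "real (n - k) = q * q" using assms by (auto simp: q_def)
  have roots: "sqrt (real k * real (n - k)) = p * q" "sqrt (real k / real (n - k)) = p / q"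
    by (simp_all add: p_def q_def real_sqrt_mult real_sqrt_divide)
  have "tail_mean n (step_mean k0 m1 m2) k - m1 = (real (n - k0) * (m2 - m1)) / (q * q)"
    unfolding tail_mean_def t q(2)[symmetric] using assms
    by (simp add: field_simps of_nat_diff)
  moreover have "1 - real k0 / real n = real (n - k0) / real n"
    using assms by (simp add: of_nat_diff field_simps)
  ultimately show ?thesis
    unfolding cusum_def h roots using q(1) by simp
qed

lemma cusum_step_mean_right:
  assumes "1 \<le> k0" "k0 \<le> k" "k < n"
  shows "cusum n (step_mean k0 m1 m2) k =
    (m2 - m1) * (real k0 / real n * sqrt (real (n - k) / real k))"
proof -
  have "(\<Sum>i=k+1..n. step_mean k0 m1 m2 i) = (\<Sum>i=k+1..n. m2)"
    using assms by (intro sum.cong) (auto simp: step_mean_def)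
  then have t: "tail_mean n (step_mean k0 m1 m2) k = m2"
    using assms by (simp add: tail_mean_def)
  have "(\<Sum>i=1..k. step_mean k0 m1 m2 i) = 
      (\<Sum>i=1..k0. step_mean k0 m1 m2 i) + (\<Sum>i=k0+1..k. step_mean k0 m1 m2 i)"
    using assms sum.ub_add_nat[of 1 k0 "step_mean k0 m1 m2" "k - k0"] by simp
  also have "(\<Sum>i=1..k0. step_mean k0 m1 m2 i) = (\<Sum>i=1..k0. m1)"
    by (intro sum.cong) (auto simp: step_mean_def)
  also have "(\<Sum>i=k0+1..k. step_mean k0 m1 m2 i) = (\<Sum>i=k0+1..k. m2)"
    by (intro sum.cong) (auto simp: step_mean_def)
  finally have h: "(\<Sum>i=1..k. step_mean k0 m1 m2 i) = real k0 * m1 + real (k - k0) * m2"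
    by simp
  define p q where "p = sqrt (real (n - k))" and "q = sqrt (real k)"
  have q: "q > 0" "real k = q * q" using assms by (auto simp: q_def)
  have roots: "sqrt (real k * real (n - k)) = p * q" "sqrt (real (n - k) / real k) = p / q"
    by (simp_all add: p_def q_def real_sqrt_mult real_sqrt_divide)
  have "m2 - head_mean (step_mean k0 m1 m2) k = (real k0 * (m2 - m1)) / (q * q)"
    unfolding head_mean_def h q(2)[symmetric] using assms
    by (simp add: field_simps of_nat_diff)
  then show ?thesis
    unfolding cusum_def t roots using q(1) by simp
qed

text \<open>The square root of the odds \<open>t / (1 - t)\<close> grows at least linearly on \<open>(0, 1)\<close>: the difference of
  the odds is at least \<open>(t - x) / (1 - t)\<close>, and the sum of the roots is at most \<open>2 / (1 - t)\<close>.\<close>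

lemma sqrt_odds_gap:
  fixes x t :: real
  assumes "0 < x" "x \<le> t" "t < 1"
  shows "(t - x) * (1 - t) / 2 \<le> (1 - t) * (sqrt (t / (1 - t)) - sqrt (x / (1 - x)))"
proof -
  define A B where "A = t / (1 - t)" and "B = x / (1 - x)"
  have B: "0 \<le> B" "B \<le> A"
    using assms by (auto simp: A_def B_def divide_simps) (simp add: algebra_simps)
  have "(t - x) / (1 - t) \<le> A - B"
  proof -
    have "A - B = (t - x) / ((1 - t) * (1 - x))"
      using assms by (simp add: A_def B_def field_simps)
    moreover have "(t - x) / (1 - t) \<le> (t - x) / ((1 - t) * (1 - x))"
      using assms by (intro divide_left_mono mult_pos_pos) (auto simp: mult_le_cancel_left1)
    ultimately show ?thesis by simp
  qed
  moreover have "A - B = (sqrt A - sqrt B) * (sqrt A + sqrt B)"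
    using B by (simp add: algebra_simps)
  moreover have "\<dots> \<le> (sqrt A - sqrt B) * (2 / (1 - t))"
  proof (intro mult_left_mono)
    have "sqrt A \<le> 1 / (1 - t)"
    proof (rule real_le_lsqrt)
      show "A \<le> (1 / (1 - t))\<^sup>2"
        using assms by (simp add: A_def power2_eq_square divide_simps) (auto simp: mult_le_one intro: order_trans[of _ 1])
    qed (use assms in auto)
    moreover have "sqrt B \<le> sqrt A" using B by simp
    ultimately have "sqrt A + sqrt B \<le> 2 * (1 / (1 - t))" by linarith
    then show "sqrt A + sqrt B \<le> 2 / (1 - t)" by simp
  qed (use B in auto)
  ultimately have "(t - x) / (1 - t) \<le> (sqrt A - sqrt B) * (2 / (1 - t))" by linarith
  then have "(t - x) \<le> (sqrt A - sqrt B) * 2"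
    using assms by (simp add: divide_simps split: if_splits)
  then have "(1 - t) * ((t - x) / 2) \<le> (1 - t) * (sqrt A - sqrt B)"
    using assms by (intro mult_left_mono) auto
  then show ?thesis by (simp add: A_def B_def mult.commute)
qed

text \<open>On both sides of \<open>k0\<close> the cusum of the means is the square root of the odds of \<open>k / n\<close> or of its
  inverse, so \<open>sqrt_odds_gap\<close> applies to the left flank directly and to the right flank after
  reflecting the unit interval.\<close>

lemma cusum_step_mean_peak:
  assumes k0: "1 \<le> k0" "k0 < n" and k: "1 \<le> k" "k < n"
    and \<kappa>: "\<kappa> \<le> real k0 / real n" "\<kappa> \<le> 1 - real k0 / real n"
  shows "\<bar>m2 - m1\<bar> * (\<kappa> / 2 * \<bar>real k / real n - real k0 / real n\<bar>)
    \<le> \<bar>cusum n (step_mean k0 m1 m2) k0\<bar> - \<bar>cusum n (step_mean k0 m1 m2) k\<bar>"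
proof -
  define x t where "x = real k / real n" and "t = real k0 / real n"
  have odds: "real i / real (n - i) = (real i / real n) / (1 - real i / real n)"
    "real (n - i) / real i = (1 - real i / real n) / (real i / real n)" if "1 \<le> i" "i < n" for i
    using that by (simp_all add: of_nat_diff field_simps)
  have xt: "0 < x" "x < 1" "0 < t" "t < 1" using k k0 by (auto simp: x_def t_def)
  show ?thesis
  proof (cases "k \<le> k0")
    case True
    then have "x \<le> t" by (simp add: x_def t_def divide_right_mono)
    have "\<kappa> / 2 * (t - x) \<le> (t - x) * (1 - t) / 2"
      using mult_left_mono[of \<kappa> "1 - t" "t - x"] \<kappa>(2) \<open>x \<le> t\<close> by (simp add: t_def[symmetric] mult.commute)
    also have "\<dots> \<le> (1 - t) * (sqrt (t / (1 - t)) - sqrt (x / (1 - x)))"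
      using sqrt_odds_gap xt \<open>x \<le> t\<close> by simp
    finally have "\<bar>m2 - m1\<bar> * (\<kappa> / 2 * \<bar>x - t\<bar>)
        \<le> \<bar>m2 - m1\<bar> * ((1 - t) * (sqrt (t / (1 - t)) - sqrt (x / (1 - x))))"
      using \<open>x \<le> t\<close> by (intro mult_left_mono) auto
    also have "\<dots> = \<bar>m2 - m1\<bar> * ((1 - t) * sqrt (t / (1 - t))) - \<bar>m2 - m1\<bar> * ((1 - t) * sqrt (x / (1 - x)))"
      by (simp only: right_diff_distrib)
    also have "\<dots> = \<bar>cusum n (step_mean k0 m1 m2) k0\<bar> - \<bar>cusum n (step_mean k0 m1 m2) k\<bar>"
      unfolding cusum_step_mean_left[OF k0(1) order.refl k0(2)] cusum_step_mean_left[OF k(1) True k0(2)]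
        odds(1)[OF k0] odds(1)[OF k]
      using xt by (simp add: x_def[symmetric] t_def[symmetric] abs_mult)
    finally show ?thesis by (simp add: x_def t_def)
  next
    case False
    then have "t \<le> x" by (simp add: x_def t_def divide_right_mono)
    have "\<kappa> / 2 * (x - t) \<le> (x - t) * t / 2"
      using mult_left_mono[of \<kappa> t "x - t"] \<kappa>(1) \<open>t \<le> x\<close> by (simp add: t_def[symmetric] mult.commute)
    also have "\<dots> \<le> t * (sqrt ((1 - t) / t) - sqrt ((1 - x) / x))"
      using sqrt_odds_gap[of "1 - x" "1 - t"] xt \<open>t \<le> x\<close> by simp
    finally have "\<bar>m2 - m1\<bar> * (\<kappa> / 2 * \<bar>x - t\<bar>)
        \<le> \<bar>m2 - m1\<bar> * (t * (sqrt ((1 - t) / t) - sqrt ((1 - x) / x)))"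
      using \<open>t \<le> x\<close> by (intro mult_left_mono) auto
    also have "\<dots> = \<bar>m2 - m1\<bar> * (t * sqrt ((1 - t) / t)) - \<bar>m2 - m1\<bar> * (t * sqrt ((1 - x) / x))"
      by (simp only: right_diff_distrib)
    also have "\<dots> = \<bar>cusum n (step_mean k0 m1 m2) k0\<bar> - \<bar>cusum n (step_mean k0 m1 m2) k\<bar>"
      unfolding cusum_step_mean_right[OF k0(1) order.refl k0(2)]
        cusum_step_mean_right[OF k0(1) less_imp_le[OF False[unfolded not_le]] k(2)]
        odds(2)[OF k0] odds(2)[OF k]
      using xt by (simp add: x_def[symmetric] t_def[symmetric] abs_mult)
    finally show ?thesis by (simp add: x_def t_def)
  qed
qed

text \<open>Comparing \<open>|V\<^sub>k|\<close> at the minimiser with its value at \<open>k0\<close>, the noise can hide a drop of the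
  signal of at most twice its uniform bound.\<close>

lemma ls_argmin_error_bound:
  assumes arg: "is_arg_min (ls_criterion n y) (\<lambda>k. k \<in> {1..n-1}) k"
    and k0: "1 \<le> k0" "k0 < n"
    and \<kappa>: "0 < \<kappa>" "\<kappa> \<le> real k0 / real n" "\<kappa> \<le> 1 - real k0 / real n"
    and head: "\<And>j. j \<in> {1..n} \<Longrightarrow> \<bar>\<Sum>i=1..j. y i - step_mean k0 m1 m2 i\<bar> \<le> a * sqrt (real j)"
    and tail: "\<And>j. j \<in> {1..<n} \<Longrightarrow> \<bar>\<Sum>i=j+1..n. y i - step_mean k0 m1 m2 i\<bar> \<le> a * sqrt (real (n - j))"
  shows "\<bar>m2 - m1\<bar> * \<bar>real k / real n - real k0 / real n\<bar> \<le> 8 * a / (\<kappa> * sqrt (real n))"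
proof -
  define e where "e i = y i - step_mean k0 m1 m2 i" for i
  define s where "s = cusum n (step_mean k0 m1 m2)"
  have k: "1 \<le> k" "k < n" using arg by (auto simp: is_arg_min_def)
  have add: "cusum n y j = s j + cusum n e j" for j
    unfolding s_def cusum_add[symmetric] by (simp add: e_def)
  have noise: "\<bar>cusum n e j\<bar> \<le> 2 * a / sqrt (real n)" if "1 \<le> j" "j < n" for j
    using cusum_noise_bound[of j n e a] head[of j] tail[of j] that by (simp add: e_def)
  have "\<bar>cusum n y k0\<bar> \<le> \<bar>cusum n y k\<bar>"
    using ls_argmin_maximises_cusum[OF arg] k0 by simp
  then have "\<bar>s k0\<bar> - \<bar>s k\<bar> \<le> 4 * a / sqrt (real n)"
    using noise[OF k] noise[OF k0] by (simp add: add)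
  then have "\<bar>m2 - m1\<bar> * (\<kappa> / 2 * \<bar>real k / real n - real k0 / real n\<bar>) \<le> 4 * a / sqrt (real n)"
    using cusum_step_mean_peak[OF k0 k \<kappa>(2,3), of m2 m1] by (simp add: s_def)
  then show ?thesis using \<kappa>(1) k by (simp add: field_simps)
qed

section \<open>A weighted maximal inequality for independent variables\<close>

context prob_space
begin

lemma indep_vars_reindex_inj:
  assumes ind: "indep_vars M' X I" and inj: "inj_on \<sigma> J" and sub: "\<sigma> ` J \<subseteq> I"
  shows "indep_vars (\<lambda>j. M' (\<sigma> j)) (\<lambda>j. X (\<sigma> j)) J"
proof -
  have "indep_vars (\<lambda>j. PiM {\<sigma> j} M') (\<lambda>j \<omega>. restrict (\<lambda>i. X i \<omega>) {\<sigma> j}) J"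
    using sub inj by (intro indep_vars_restrict[OF ind]) (auto simp: disjoint_family_on_def inj_on_def)
  then have "indep_vars (\<lambda>j. M' (\<sigma> j)) (\<lambda>j \<omega>. (\<lambda>f. f (\<sigma> j)) (restrict (\<lambda>i. X i \<omega>) {\<sigma> j})) J"
    by (rule indep_vars_compose2) measurable
  then show ?thesis by simp
qed

text \<open>Stop the sums \<open>S\<^sub>k\<close> at the first crossing of the level, and let \<open>G\<close> accumulate the increments
  \<open>c\<^sub>k\<^sup>2 (S\<^sub>k\<^sup>2 - S\<^sub>k\<^sub>-\<^sub>1\<^sup>2)\<close> up to that time.  Because the weights decrease, \<open>G\<close> dominates
  \<open>c\<^sub>k\<^sup>2 S\<^sub>k\<^sup>2\<close> at the current index, so it is at least \<open>\<epsilon>\<^sup>2\<close> on the event of a crossing and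
  nonnegative elsewhere.  Whether the process has been stopped before time \<open>k\<close> depends only on earlier
  variables, so the cross terms \<open>X\<^sub>k S\<^sub>k\<^sub>-\<^sub>1\<close> have mean zero and the mean of \<open>G\<close> is at most the
  weighted sum of the variances.  Markov's inequality for \<open>G\<close> then concludes.\<close>

lemma hajek_renyi:
  fixes X :: "nat \<Rightarrow> 'a \<Rightarrow> real" and c :: "nat \<Rightarrow> real"
  assumes ind: "indep_vars (\<lambda>_. borel) X {1..n}"
    and bd: "\<And>i \<omega>. i \<in> {1..n} \<Longrightarrow> \<omega> \<in> space M \<Longrightarrow> \<bar>X i \<omega>\<bar> \<le> b"
    and centred: "\<And>i. i \<in> {1..n} \<Longrightarrow> expectation (X i) = 0"
    and decr: "\<And>i. i \<in> {1..n} \<Longrightarrow> 0 \<le> c i" "\<And>i. 1 \<le> i \<Longrightarrow> i < n \<Longrightarrow> c (Suc i) \<le> c i"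
    and \<epsilon>: "\<epsilon> > 0"
  shows "prob {\<omega>\<in>space M. \<exists>k\<in>{1..n}. \<epsilon> \<le> c k * \<bar>\<Sum>i=1..k. X i \<omega>\<bar>}
    \<le> (\<Sum>k=1..n. (c k)\<^sup>2 * expectation (\<lambda>\<omega>. (X k \<omega>)\<^sup>2)) / \<epsilon>\<^sup>2"
proof -
  define S where "S x k = (\<Sum>i=1..k. x i)" for x :: "nat \<Rightarrow> real" and k
  \<comment> \<open>The time \<open>k\<close> itself is left out, so that \<open>D x k\<close> is independent of the \<open>k\<close>-th variable.\<close>
  define D where "D x k = (of_bool (\<forall>j\<in>{1..<k}. c j * \<bar>S x j\<bar> < \<epsilon>) :: real)" for x k
  define G where "G x m = (\<Sum>k=1..m. (c k)\<^sup>2 * (((S x k)\<^sup>2 - (S x (k-1))\<^sup>2) * D x k))" for x m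
  define p where "p \<omega> i = X i \<omega>" for \<omega> i
  have D_cases: "D x k = 0 \<or> D x k = 1" for x k unfolding D_def of_bool_def by presburger
  have S_Suc: "S x (Suc k) = S x k + x (Suc k)" for x k by (simp add: S_def)
  have path: "(D x (Suc m) = 1 \<longrightarrow> (c m)\<^sup>2 * (S x m)\<^sup>2 \<le> G x m) \<and>
      (D x (Suc m) = 0 \<longrightarrow> \<epsilon>\<^sup>2 \<le> G x m)" if "m \<le> n" for x m
    using that
  proof (induction m)
    case 0
    then show ?case by (simp add: D_def G_def S_def)
  next
    case (Suc m)
    have G: "G x (Suc m) = G x m + (c (Suc m))\<^sup>2 * (((S x (Suc m))\<^sup>2 - (S x m)\<^sup>2) * D x (Suc m))"
      by (simp add: G_def)
    have D: "D x (Suc (Suc m)) = D x (Suc m) * of_bool (c (Suc m) * \<bar>S x (Suc m)\<bar> < \<epsilon>)"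
      by (auto simp: D_def less_Suc_eq)
    show ?case
    proof (cases "D x (Suc m) = 1")
      case True
      have "(c (Suc m))\<^sup>2 * (S x m)\<^sup>2 \<le> G x m"
      proof (cases "m = 0")
        case True
        then show ?thesis by (simp add: S_def G_def)
      next
        case False
        then have "(c (Suc m))\<^sup>2 \<le> (c m)\<^sup>2"
          using Suc.prems decr by (intro power_mono) auto
        then have "(c (Suc m))\<^sup>2 * (S x m)\<^sup>2 \<le> (c m)\<^sup>2 * (S x m)\<^sup>2"
          by (intro mult_right_mono) auto
        with Suc False True show ?thesis by auto
      qed
      then have le: "(c (Suc m))\<^sup>2 * (S x (Suc m))\<^sup>2 \<le> G x (Suc m)"
        by (simp add: G True algebra_simps)
      have "\<epsilon>\<^sup>2 \<le> (c (Suc m))\<^sup>2 * (S x (Suc m))\<^sup>2" if "\<epsilon> \<le> c (Suc m) * \<bar>S x (Suc m)\<bar>"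
        using power_mono[OF that, of 2] \<epsilon> by (simp add: power_mult_distrib)
      with le show ?thesis by (auto simp: D True)
    next
      case False
      then have "D x (Suc m) = 0" using D_cases by blast
      with Suc show ?thesis by (simp add: G D)
    qed
  qed
  have path_nonneg: "0 \<le> G x n" for x
  proof -
    have "0 \<le> (c n)\<^sup>2 * (S x n)\<^sup>2" "0 \<le> \<epsilon>\<^sup>2" by simp_all
    then show ?thesis using path[of n x] D_cases[of x "Suc n"] by linarith
  qed
  have path_crossed: "\<epsilon>\<^sup>2 \<le> G x n" if "\<exists>k\<in>{1..n}. \<epsilon> \<le> c k * \<bar>S x k\<bar>" for x
  proof -
    have "D x (Suc n) = 0" using that by (force simp: D_def)
    then show ?thesis using path[of n x] by simp
  qed
  have rv: "X i \<in> borel_measurable M" if "i \<in> {1..n}" for i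
    using ind that by (auto simp: indep_vars_def)
  have Sm: "(\<lambda>\<omega>. S (p \<omega>) k) \<in> borel_measurable M" if "k \<le> n" for k
    unfolding S_def p_def using that by (intro borel_measurable_sum rv) auto
  have Dm: "(\<lambda>\<omega>. D (p \<omega>) k) \<in> borel_measurable M" if "k \<le> Suc n" for k
  proof -
    have [measurable]: "(\<lambda>\<omega>. S (p \<omega>) j) \<in> borel_measurable M" if "j \<in> {1..<k}" for j
      using that \<open>k \<le> Suc n\<close> by (intro Sm) auto
    show ?thesis unfolding D_def by measurable
  qed
  have Sb: "\<bar>S (p \<omega>) k\<bar> \<le> real n * \<bar>b\<bar>" if "\<omega> \<in> space M" "k \<le> n" for \<omega> k
  proof -
    have "\<bar>S (p \<omega>) k\<bar> \<le> (\<Sum>i=1..k. \<bar>b\<bar>)"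
      unfolding S_def p_def using that
      by (intro order_trans[OF sum_abs] sum_mono) (auto intro!: order_trans[OF bd])
    also have "\<dots> \<le> real n * \<bar>b\<bar>" using that by (auto intro: mult_right_mono)
    finally show ?thesis .
  qed
  have intX2D: "integrable M (\<lambda>\<omega>. (X k \<omega>)\<^sup>2 * D (p \<omega>) k)"
    and intX2: "integrable M (\<lambda>\<omega>. (X k \<omega>)\<^sup>2)"
    and intX: "integrable M (X k)" 
    and intSD: "integrable M (\<lambda>\<omega>. S (p \<omega>) (k-1) * D (p \<omega>) k)" if k: "k \<in> {1..n}" for k
  proof -
    note [measurable] = rv[OF k]
    have [measurable]: "(\<lambda>\<omega>. D (p \<omega>) k) \<in> borel_measurable M" "(\<lambda>\<omega>. S (p \<omega>) (k-1)) \<in> borel_measurable M"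
      using k by (auto intro!: Dm Sm)
    have X2: "(X k \<omega>)\<^sup>2 \<le> \<bar>b\<bar>\<^sup>2" if "\<omega> \<in> space M" for \<omega>
      using bd[OF k that] by (simp add: abs_le_square_iff[symmetric])
    show "integrable M (\<lambda>\<omega>. (X k \<omega>)\<^sup>2 * D (p \<omega>) k)"
    proof (rule integrable_const_bound[of _ "\<bar>b\<bar>\<^sup>2"])
      show "AE \<omega> in M. norm ((X k \<omega>)\<^sup>2 * D (p \<omega>) k) \<le> \<bar>b\<bar>\<^sup>2"
        using X2 by (intro AE_I2) (auto simp: D_def)
    qed measurable
    show "integrable M (\<lambda>\<omega>. (X k \<omega>)\<^sup>2)"
    proof (rule integrable_const_bound[of _ "\<bar>b\<bar>\<^sup>2"])
      show "AE \<omega> in M. norm ((X k \<omega>)\<^sup>2) \<le> \<bar>b\<bar>\<^sup>2"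
        using X2 by (intro AE_I2) auto
    qed measurable
    show "integrable M (X k)"
      using bd[OF k] by (intro integrable_const_bound[of _ b] AE_I2) auto
    show "integrable M (\<lambda>\<omega>. S (p \<omega>) (k-1) * D (p \<omega>) k)"
    proof (rule integrable_const_bound[of _ "real n * \<bar>b\<bar>"])
      show "AE \<omega> in M. norm (S (p \<omega>) (k-1) * D (p \<omega>) k) \<le> real n * \<bar>b\<bar>"
        using Sb[of _ "k-1"] k by (intro AE_I2) (auto simp: D_def)
    qed measurable
  qed
  have prod: "expectation (\<lambda>\<omega>. X k \<omega> * (S (p \<omega>) (k-1) * D (p \<omega>) k)) = 0"
    and intprod: "integrable M (\<lambda>\<omega>. X k \<omega> * (S (p \<omega>) (k-1) * D (p \<omega>) k))" if k: "k \<in> {1..n}" for k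
  proof -
    have S_past: "S (restrict x {1..<k}) j = S x j" if "j < k" for x j
      unfolding S_def using that by (intro sum.cong) auto
    then have D_past: "D (restrict x {1..<k}) k = D x k" for x
      unfolding D_def by (intro arg_cong[where f=of_bool] ball_cong) auto
    have meas: "(\<lambda>x. S x (k-1) * D x k) \<in> borel_measurable (PiM {1..<k} (\<lambda>_. borel))"
    proof -
      have Spast[measurable]: "(\<lambda>x. S x j) \<in> borel_measurable (PiM {1..<k} (\<lambda>_. borel))" if "j < k" for j
        unfolding S_def using that by (intro borel_measurable_sum measurable_component_singleton) auto
      have "(\<lambda>x. D x k) \<in> borel_measurable (PiM {1..<k} (\<lambda>_. borel))"
      proof -
        have [measurable]: "(\<lambda>x. S x j) \<in> borel_measurable (PiM {1..<k} (\<lambda>_. borel))" if "j \<in> {1..<k}" for j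
          using that Spast by simp
        show ?thesis unfolding D_def by measurable
      qed
      moreover have "k - 1 < k" using k by auto
      ultimately show ?thesis by measurable
    qed
    have "indep_var borel ((\<lambda>f. f k) \<circ> (\<lambda>\<omega>. restrict (\<lambda>i. X i \<omega>) {k}))
        borel ((\<lambda>x. S x (k-1) * D x k) \<circ> (\<lambda>\<omega>. restrict (\<lambda>i. X i \<omega>) {1..<k}))"
      using k by (intro indep_var_compose[OF indep_var_restrict[OF ind]] meas) auto
    moreover have "(\<lambda>f. f k) \<circ> (\<lambda>\<omega>. restrict (\<lambda>i. X i \<omega>) {k}) = X k"
      by (auto simp: fun_eq_iff)
    moreover have "(\<lambda>x. S x (k-1) * D x k) \<circ> (\<lambda>\<omega>. restrict (\<lambda>i. X i \<omega>) {1..<k})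
        = (\<lambda>\<omega>. S (p \<omega>) (k-1) * D (p \<omega>) k)"
      using k S_past[of "k - 1"] D_past by (auto simp: fun_eq_iff p_def[abs_def])
    ultimately have iv: "indep_var borel (X k) borel (\<lambda>\<omega>. S (p \<omega>) (k-1) * D (p \<omega>) k)" by simp
    show "expectation (\<lambda>\<omega>. X k \<omega> * (S (p \<omega>) (k-1) * D (p \<omega>) k)) = 0"
      using indep_var_lebesgue_integral[OF iv intX[OF k] intSD[OF k]] centred[OF k] by simp
    show "integrable M (\<lambda>\<omega>. X k \<omega> * (S (p \<omega>) (k-1) * D (p \<omega>) k))"
      using indep_var_integrable[OF iv intX[OF k] intSD[OF k]] .
  qed
  have increment: "((S (p \<omega>) k)\<^sup>2 - (S (p \<omega>) (k-1))\<^sup>2) * D (p \<omega>) k =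
      (X k \<omega>)\<^sup>2 * D (p \<omega>) k + 2 * (X k \<omega> * (S (p \<omega>) (k-1) * D (p \<omega>) k))" if "k \<in> {1..n}" for \<omega> k
  proof -
    have "S (p \<omega>) k = S (p \<omega>) (k-1) + X k \<omega>" using that S_Suc[of "p \<omega>" "k-1"] by (simp add: p_def)
    then show ?thesis by (simp add: power2_eq_square algebra_simps)
  qed
  have int_increment: "integrable M (\<lambda>\<omega>. ((S (p \<omega>) k)\<^sup>2 - (S (p \<omega>) (k-1))\<^sup>2) * D (p \<omega>) k)" if k: "k \<in> {1..n}" for k
    unfolding increment[OF k] using intX2D[OF k] intprod[OF k] by auto
  have intG: "integrable M (\<lambda>\<omega>. G (p \<omega>) n)"
    unfolding G_def by (intro Bochner_Integration.integrable_sum integrable_mult_right int_increment)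
  have EG: "expectation (\<lambda>\<omega>. G (p \<omega>) n) \<le> (\<Sum>k=1..n. (c k)\<^sup>2 * expectation (\<lambda>\<omega>. (X k \<omega>)\<^sup>2))"
  proof -
    have "expectation (\<lambda>\<omega>. G (p \<omega>) n) = 
        (\<Sum>k=1..n. expectation (\<lambda>\<omega>. (c k)\<^sup>2 * (((S (p \<omega>) k)\<^sup>2 - (S (p \<omega>) (k-1))\<^sup>2) * D (p \<omega>) k)))"
      unfolding G_def by (intro Bochner_Integration.integral_sum integrable_mult_right int_increment)
    also have "\<dots> = (\<Sum>k=1..n. (c k)\<^sup>2 * expectation (\<lambda>\<omega>. (X k \<omega>)\<^sup>2 * D (p \<omega>) k))"
    proof (rule sum.cong[OF refl])
      fix k assume k: "k \<in> {1..n}"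
      show "expectation (\<lambda>\<omega>. (c k)\<^sup>2 * (((S (p \<omega>) k)\<^sup>2 - (S (p \<omega>) (k-1))\<^sup>2) * D (p \<omega>) k)) =
          (c k)\<^sup>2 * expectation (\<lambda>\<omega>. (X k \<omega>)\<^sup>2 * D (p \<omega>) k)"
        unfolding increment[OF k] using intX2D[OF k] intprod[OF k] prod[OF k] by simp
    qed
    also have "\<dots> \<le> (\<Sum>k=1..n. (c k)\<^sup>2 * expectation (\<lambda>\<omega>. (X k \<omega>)\<^sup>2))"
      using intX2D intX2 by (intro sum_mono mult_left_mono integral_mono) (auto simp: D_def)
    finally show ?thesis .
  qed
  have "{\<omega>\<in>space M. \<exists>k\<in>{1..n}. \<epsilon> \<le> c k * \<bar>\<Sum>i=1..k. X i \<omega>\<bar>} \<subseteq> {\<omega>\<in>space M. \<epsilon>\<^sup>2 \<le> G (p \<omega>) n}"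
    using path_crossed[of "p _"] by (auto simp: S_def p_def)
  moreover have "{\<omega>\<in>space M. \<epsilon>\<^sup>2 \<le> G (p \<omega>) n} \<in> events"
    using borel_measurable_integrable[OF intG] by measurable
  ultimately have "prob {\<omega>\<in>space M. \<exists>k\<in>{1..n}. \<epsilon> \<le> c k * \<bar>\<Sum>i=1..k. X i \<omega>\<bar>}
      \<le> prob {\<omega>\<in>space M. \<epsilon>\<^sup>2 \<le> G (p \<omega>) n}"
    by (rule finite_measure_mono)
  also have "\<dots> \<le> expectation (\<lambda>\<omega>. G (p \<omega>) n) / \<epsilon>\<^sup>2"
    using integral_Markov_inequality_measure[OF intG, of "{}" "\<epsilon>\<^sup>2"] path_nonneg \<epsilon> by simp
  also have "\<dots> \<le> (\<Sum>k=1..n. (c k)\<^sup>2 * expectation (\<lambda>\<omega>. (X k \<omega>)\<^sup>2)) / \<epsilon>\<^sup>2"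
    using EG by (intro divide_right_mono) auto
  finally show ?thesis .
qed

text \<open>With the weights \<open>1 / sqrt k\<close> the variances add up to a harmonic sum.\<close>

lemma sqrt_normalised_maximal_inequality:
  fixes X :: "nat \<Rightarrow> 'a \<Rightarrow> real"
  assumes ind: "indep_vars (\<lambda>_. borel) X {1..n}"
    and bd: "\<And>i \<omega>. i \<in> {1..n} \<Longrightarrow> \<omega> \<in> space M \<Longrightarrow> \<bar>X i \<omega>\<bar> \<le> b"
    and centred: "\<And>i. i \<in> {1..n} \<Longrightarrow> expectation (X i) = 0"
    and var: "\<And>i. i \<in> {1..n} \<Longrightarrow> expectation (\<lambda>\<omega>. (X i \<omega>)\<^sup>2) \<le> V"
    and n: "n \<ge> 1" and a: "a > 0"
  shows "prob {\<omega>\<in>space M. \<exists>k\<in>{1..n}. a * sqrt (real k) \<le> \<bar>\<Sum>i=1..k. X i \<omega>\<bar>}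
    \<le> V * (1 + ln (real n)) / a\<^sup>2"
proof -
  have V: "V \<ge> 0"
    using var[of 1] n by (auto intro: order_trans[rotated])
  have "prob {\<omega>\<in>space M. \<exists>k\<in>{1..n}. a * sqrt (real k) \<le> \<bar>\<Sum>i=1..k. X i \<omega>\<bar>} =
      prob {\<omega>\<in>space M. \<exists>k\<in>{1..n}. a \<le> 1 / sqrt (real k) * \<bar>\<Sum>i=1..k. X i \<omega>\<bar>}"
    by (intro arg_cong[where f=prob] Collect_cong conj_cong refl bex_cong)
       (auto simp: field_simps)
  also have "\<dots> \<le> (\<Sum>k=1..n. (1 / sqrt (real k))\<^sup>2 * expectation (\<lambda>\<omega>. (X k \<omega>)\<^sup>2)) / a\<^sup>2"
    by (rule hajek_renyi[OF ind bd centred]) (use a in \<open>auto simp: frac_le\<close>)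
  also have "\<dots> \<le> (\<Sum>k=1..n. inverse (real k) * V) / a\<^sup>2"
    using var by (intro divide_right_mono sum_mono) (auto simp: power_divide field_simps)
  also have "\<dots> = V * harm n / a\<^sup>2"
    by (simp add: harm_def sum_distrib_left mult.commute)
  also have "harm n \<le> 1 + ln (real n)"
    using euler_mascheroni_sequence_decreasing[of 1 n] n by (simp add: harm_def)
  then have "V * harm n / a\<^sup>2 \<le> V * (1 + ln (real n)) / a\<^sup>2"
    using V by (intro divide_right_mono mult_left_mono) auto
  finally show ?thesis .
qed

end

section \<open>Alternating integrals along Poisson paths\<close>

text \<open>The alternating sign is a difference of monotone functions, \<open>(-1)^m = 1 - 2 m + 4 \<lfloor>m / 2\<rfloor>\<close>.\<close>

lemma minus_one_power_integrable:
  fixes N :: "real \<Rightarrow> nat"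
  assumes "mono_on {a..b} N"
  shows "(\<lambda>s. (-1::real) ^ N s) integrable_on {a..b}"
proof -
  have eq: "(-1::real) ^ m = 1 - 2 * real m + 4 * real (m div 2)" for m :: nat
    by (cases "even m") (auto elim!: evenE oddE)
  have "(\<lambda>s. real (N s)) integrable_on {a..b}" "(\<lambda>s. real (N s div 2)) integrable_on {a..b}"
    using assms by (auto intro!: integrable_on_mono_on div_le_mono simp: mono_on_def)
  then show ?thesis unfolding eq
    by (intro integrable_add integrable_diff integrable_on_cmult_left) auto
qed

lemma integral_positive_if_positive_on_subinterval:
  fixes f :: "real \<Rightarrow> real"
  assumes f: "f integrable_on {a..b}" "\<And>x. x \<in> {a..b} \<Longrightarrow> 0 \<le> f x"
    and sub: "a \<le> c" "c < d" "d \<le> b" and pos: "\<epsilon> > 0" "\<And>x. x \<in> {c..d} \<Longrightarrow> \<epsilon> \<le> f x"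
  shows "0 < integral {a..b} f"
proof -
  have cd: "f integrable_on {c..d}" using f(1) sub by (rule_tac integrable_on_subinterval) auto
  have "0 < \<epsilon> * (d - c)" using sub pos by simp
  also have "\<dots> = integral {c..d} (\<lambda>_. \<epsilon>)" using sub by simp
  also have "\<dots> \<le> integral {c..d} f" using cd pos(2) by (intro integral_le) auto
  also have "\<dots> \<le> integral {a..b} f" using f cd sub by (intro integral_subset_le) auto
  finally show ?thesis .
qed

lemma right_continuous_nat_locally_constant:
  fixes N :: "real \<Rightarrow> nat"
  assumes "continuous (at_right a) N" "a < b"
  obtains d where "a < d" "d < b" "\<And>x. x \<in> {a..d} \<Longrightarrow> N x = N a"
proof -
  have "(N \<longlongrightarrow> N a) (at_right a)" using assms(1) by (simp add: continuous_within)
  then have "\<forall>\<^sub>F x in at_right a. N x = N a"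
    by (rule tendsto_discrete[THEN iffD1])
  then obtain e where e: "e > a" "\<And>y. a < y \<Longrightarrow> y < e \<Longrightarrow> N y = N a"
    by (auto simp: eventually_at_right_field)
  obtain d where "a < d" "d < min b e" using dense[of a "min b e"] assms(2) e(1) by auto
  then show ?thesis using e(2) by (intro that[of d]) (auto simp: le_less)
qed

text \<open>At the first grid point where \<open>N\<close> exceeds \<open>N a\<close> it equals \<open>N a + 1\<close>, since it grows by at most one
  over each piece.  This grid point lies before \<open>b\<close>, because \<open>N\<close> does not grow over the last piece.
  By right continuity the sign therefore takes both values on intervals of positive length, and
  the integral cannot be extremal.\<close>

lemma alternating_integral_unit_jumps:
  fixes N :: "real \<Rightarrow> nat" and m :: nat
  assumes mono: "mono_on {a..b} N" and rc: "\<And>t. a \<le> t \<Longrightarrow> t < b \<Longrightarrow> continuous (at_right t) N"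
    and u: "u 0 = a" "u m = b" "\<And>j. j < m \<Longrightarrow> u j < u (Suc j)"
    and unit: "\<And>j. j < m \<Longrightarrow> N (u (Suc j)) \<le> Suc (N (u j))"
    and last: "m > 0" "N (u (m - 1)) = N b"
    and jump: "N a < N b"
  shows "\<bar>integral {a..b} (\<lambda>s. (-1::real) ^ N s)\<bar> < b - a"
proof -
  define j where "j = (LEAST j. N (u (Suc j)) > N a)"
  have ex: "N (u (Suc (m - 1))) > N a" using u last jump by simp
  have jump_j: "N (u (Suc j)) > N a" unfolding j_def by (rule LeastI[of _ "m-1"]) fact
  have "Suc j < m"
  proof -
    have "m \<ge> 2" using last jump u by (cases "m = 1") auto
    then have "N (u (Suc (m - 2))) > N a" using last jump by (simp add: numeral_2_eq_2 Suc_diff_Suc)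
    then have "j \<le> m - 2" unfolding j_def by (rule Least_le)
    then show ?thesis using \<open>m \<ge> 2\<close> by simp
  qed
  have u_mono: "u i \<le> u k" if "i \<le> k" "k \<le> m" for i k
    using that by (induction k) (auto simp: le_Suc_eq less_imp_le intro: order_trans[OF _ less_imp_le[OF u(3)]])
  have range: "a \<le> u i" "u i \<le> b" if "i \<le> m" for i
    using u_mono[of 0 i] u_mono[of i m] that u by auto
  have below: "u (Suc j) < b"
    using u(3)[OF \<open>Suc j < m\<close>] range(2)[of "Suc (Suc j)"] \<open>Suc j < m\<close> by simp
  have "N (u j) \<le> N a"
  proof (cases j)
    case 0 then show ?thesis using u by simp
  next
    case (Suc i)
    then have "\<not> N (u (Suc i)) > N a" unfolding j_def by (metis not_less_Least lessI)
    then show ?thesis using Suc by simp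
  qed
  then have Nj: "N (u (Suc j)) = Suc (N a)" using jump_j unit[of j] \<open>Suc j < m\<close> by simp
  have ab: "a < b" using below range(1)[of "Suc j"] \<open>Suc j < m\<close> by simp
  define f where "f s = (-1::real) ^ N s" for s
  define c where "c = (-1::real) ^ N a"
  have c: "c = 1 \<or> c = -1" "c * c = 1" unfolding c_def by (cases "even (N a)"; simp)+
  have f: "f s = 1 \<or> f s = -1" for s unfolding f_def by (cases "even (N s)") auto
  have int: "f integrable_on {a..b}" unfolding f_def using minus_one_power_integrable[OF mono] .
  have int': "(\<lambda>s. c * f s) integrable_on {a..b}" using integrable_cmul[OF int, of c] by simp
  obtain d1 where d1: "a < d1" "d1 < b" "\<And>x. x \<in> {a..d1} \<Longrightarrow> N x = N a"
    using right_continuous_nat_locally_constant[OF rc[of a] ab] ab by blast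
  obtain d2 where d2: "u (Suc j) < d2" "d2 < b" "\<And>x. x \<in> {u (Suc j)..d2} \<Longrightarrow> N x = Suc (N a)"
    using right_continuous_nat_locally_constant[OF rc[of "u (Suc j)"] below] below 
      range(1)[of "Suc j"] \<open>Suc j < m\<close> Nj by auto
  have bnd: "-1 \<le> c * f s" "c * f s \<le> 1" for s using c(1) f[of s] by auto
  have "0 < integral {a..b} (\<lambda>s. 1 + c * f s)"
  proof (rule integral_positive_if_positive_on_subinterval[of _ _ _ a d1 2])
    show "(\<lambda>s. 1 + c * f s) integrable_on {a..b}" using int' by (intro integrable_add) auto
    show "2 \<le> 1 + c * f s" if "s \<in> {a..d1}" for s
      using d1(3)[OF that] c(2) by (simp add: f_def c_def[symmetric])
    show "0 \<le> 1 + c * f s" for s using bnd(1)[of s] by linarith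
  qed (use d1 in auto)
  moreover have "0 < integral {a..b} (\<lambda>s. 1 - c * f s)"
  proof (rule integral_positive_if_positive_on_subinterval[of _ _ _ "u (Suc j)" d2 2])
    show "(\<lambda>s. 1 - c * f s) integrable_on {a..b}" using int' by (intro integrable_diff) auto
    show "2 \<le> 1 - c * f s" if "s \<in> {u (Suc j)..d2}" for s
      using d2(3)[OF that] c(2) by (simp add: f_def c_def[symmetric])
    show "0 \<le> 1 - c * f s" for s using bnd(2)[of s] by linarith
  qed (use d2 range(1)[of "Suc j"] \<open>Suc j < m\<close> in auto)
  moreover have "integral {a..b} (\<lambda>s. 1 + c * f s) = (b - a) + c * integral {a..b} f"
    "integral {a..b} (\<lambda>s. 1 - c * f s) = (b - a) - c * integral {a..b} f"
    using integral_add[of "\<lambda>_. 1" "{a..b}" "\<lambda>s. c * f s"]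
      integral_diff[of "\<lambda>_. 1" "{a..b}" "\<lambda>s. c * f s"] int' ab integrable_const_ivl[of "1::real" a b] by simp_all
  ultimately have "\<bar>c * integral {a..b} f\<bar> < b - a" by linarith
  then show ?thesis using c(1) by (auto simp: f_def[abs_def])
qed

text \<open>If the intensity were not integrable, its integral would be \<open>0\<close> by convention, so the bounds hold
  without discussing integrability.\<close>

lemma integral_step_intensity_bounds:
  assumes "0 \<le> lam1" "0 \<le> lam2" "s \<le> t"
  shows "0 \<le> integral {s..t} (step_intensity lam1 lam2 \<theta>)"
    "integral {s..t} (step_intensity lam1 lam2 \<theta>) \<le> max lam1 lam2 * (t - s)"
proof -
  let ?f = "step_intensity lam1 lam2 \<theta>"
  have "0 \<le> integral {s..t} ?f \<and> integral {s..t} ?f \<le> max lam1 lam2 * (t - s)"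
  proof (cases "?f integrable_on {s..t}")
    case True
    have "integral {s..t} ?f \<le> integral {s..t} (\<lambda>_. max lam1 lam2)"
      using True by (intro integral_le) (auto simp: step_intensity_def)
    then show ?thesis using assms True
      by (auto intro!: integral_nonneg simp: step_intensity_def mult.commute)
  next
    case False
    then show ?thesis using assms by (simp add: not_integrable_integral)
  qed
  then show "0 \<le> integral {s..t} ?f" "integral {s..t} ?f \<le> max lam1 lam2 * (t - s)" by auto
qed

lemma integral_step_intensity_left:
  assumes "s \<le> t" "t \<le> \<theta>"
  shows "integral {s..t} (step_intensity lam1 lam2 \<theta>) = lam1 * (t - s)"
proof -
  have "integral {s..t} (step_intensity lam1 lam2 \<theta>) = integral {s..t} (\<lambda>_. lam1)"
    using assms by (intro integral_cong) (auto simp: step_intensity_def)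
  then show ?thesis using assms by simp
qed

lemma integral_step_intensity_right:
  assumes "s \<le> t" "\<theta> \<le> s"
  shows "integral {s..t} (step_intensity lam1 lam2 \<theta>) = lam2 * (t - s)"
proof -
  have "integral {s..t} (step_intensity lam1 lam2 \<theta>) = integral {s..t} (\<lambda>_. lam2)"
    using assms by (intro integral_spike[of "{s}"]) (auto simp: step_intensity_def)
  then show ?thesis using assms by simp
qed

text \<open>Cut the interval into \<open>m\<close> pieces of length \<open>h = (b - a) / m\<close>.  The event \<open>E m\<close> that some piece has
  two or more events, or that the last piece has any, has probability at most
  \<open>m (\<Lambda> h)\<^sup>2 + \<Lambda> h = O(1/m)\<close>, so almost surely one of the \<open>E m\<close> fails; on such a path
  \<open>alternating_integral_unit_jumps\<close> applies.\<close>

lemma poisson_unit_jumps_AE: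
  fixes N :: "real \<Rightarrow> 'a \<Rightarrow> nat"
  assumes N: "inhom_poisson_process M lam T N"
    and bound: "\<And>s t. 0 \<le> s \<Longrightarrow> s \<le> t \<Longrightarrow> t \<le> T \<Longrightarrow>
       0 \<le> integral {s..t} lam \<and> integral {s..t} lam \<le> \<Lambda> * (t - s)"
    and ab: "0 \<le> a" "a < b" "b \<le> T"
  shows "AE \<omega> in M. N a \<omega> < N b \<omega> \<longrightarrow> \<bar>integral {a..b} (\<lambda>s. (-1::real) ^ N s \<omega>)\<bar> < b - a"
proof -
  interpret prob_space M using N by (simp add: inhom_poisson_process_def)
  have meas: "N t \<in> measurable M (count_space UNIV)" if "0 \<le> t" "t \<le> T" for t
    using N that by (auto simp: inhom_poisson_process_def)
  have path: "mono_on {0..T} (\<lambda>t. N t \<omega>)"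
    "\<And>t. t \<in> {0..<T} \<Longrightarrow> continuous (at_right t) (\<lambda>s. N s \<omega>)" if "\<omega> \<in> space M" for \<omega>
    using N that by (auto simp: inhom_poisson_process_def)
  have law: "prob {\<omega>\<in>space M. N t \<omega> - N s \<omega> = j} =
      exp (- integral {s..t} lam) * integral {s..t} lam ^ j / fact j"
    if "0 \<le> s" "s \<le> t" "t \<le> T" for s t j
    using N that by (auto simp: inhom_poisson_process_def)
  have ev[measurable]: "{\<omega>\<in>space M. P (N t \<omega> - N s \<omega>)} \<in> events"
    if "0 \<le> s" "s \<le> t" "t \<le> T" for s t and P :: "nat \<Rightarrow> bool"
  proof -
    have [measurable]: "N s \<in> measurable M (count_space UNIV)" "N t \<in> measurable M (count_space UNIV)"
      using that by (auto intro: meas)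
    show ?thesis by measurable
  qed
  have one: "prob {\<omega>\<in>space M. N t \<omega> - N s \<omega> \<noteq> 0} \<le> \<Lambda> * (t - s)"
    if st: "0 \<le> s" "s \<le> t" "t \<le> T" for s t
  proof -
    have "prob {\<omega>\<in>space M. N t \<omega> - N s \<omega> \<noteq> 0} = 1 - prob {\<omega>\<in>space M. N t \<omega> - N s \<omega> = 0}"
      using prob_neg[OF ev[OF st, of "\<lambda>j. j = 0"]] .
    also have "\<dots> = 1 - exp (- integral {s..t} lam)" using law[OF st, of 0] by simp
    also have "\<dots> \<le> integral {s..t} lam" using exp_ge_add_one_self[of "- integral {s..t} lam"] by simp
    also have "\<dots> \<le> \<Lambda> * (t - s)" using bound[OF st] by simp
    finally show ?thesis .
  qed
  have two: "prob {\<omega>\<in>space M. 2 \<le> N t \<omega> - N s \<omega>} \<le> (\<Lambda> * (t - s))\<^sup>2"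
    if st: "0 \<le> s" "s \<le> t" "t \<le> T" for s t
  proof -
    define x where "x = integral {s..t} lam"
    have x: "0 \<le> x" "x \<le> \<Lambda> * (t - s)" using bound[OF st] by (auto simp: x_def)
    have "{\<omega>\<in>space M. 2 \<le> N t \<omega> - N s \<omega>} = space M -
        ({\<omega>\<in>space M. N t \<omega> - N s \<omega> = 0} \<union> {\<omega>\<in>space M. N t \<omega> - N s \<omega> = 1})" by auto
    then have "prob {\<omega>\<in>space M. 2 \<le> N t \<omega> - N s \<omega>} = 1 -
        prob ({\<omega>\<in>space M. N t \<omega> - N s \<omega> = 0} \<union> {\<omega>\<in>space M. N t \<omega> - N s \<omega> = 1})"
      using ev[OF st, of "\<lambda>j. j = 0"] ev[OF st, of "\<lambda>j. j = 1"] by (simp only: prob_compl sets.Un)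
    also have "\<dots> = 1 - (exp (- x) + exp (- x) * x)"
      using ev[OF st, of "\<lambda>j. j = 0"] ev[OF st, of "\<lambda>j. j = 1"] law[OF st, of 0] law[OF st, of 1]
      by (subst finite_measure_Union) (auto simp: x_def)
    also have "\<dots> \<le> x\<^sup>2"
    proof -
      have "(1 - x) * (1 + x) \<le> exp (- x) * (1 + x)"
        using x exp_ge_add_one_self[of "-x"] by (intro mult_right_mono) auto
      then show ?thesis by (simp add: power2_eq_square algebra_simps)
    qed
    also have "\<dots> \<le> (\<Lambda> * (t - s))\<^sup>2" using x by (intro power_mono) auto
    finally show ?thesis .
  qed
  define h where "h m = (b - a) / real m" for m :: nat
  define u where "u m j = a + real j * h m" for m j :: nat
  define E where "E m = (\<Union>j<m. {\<omega>\<in>space M. 2 \<le> N (u m (Suc j)) \<omega> - N (u m j) \<omega>}) \<union>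
      {\<omega>\<in>space M. N b \<omega> - N (u m (m - 1)) \<omega> \<noteq> 0}" for m
  have h: "h m > 0" "real m * h m = b - a" if "m > 0" for m using that ab by (auto simp: h_def)
  have u: "0 \<le> u m j" "u m j \<le> u m (Suc j)" "u m j < u m (Suc j)" "u m j \<le> b" "u m (Suc j) - u m j = h m" 
    if "m > 0" "j \<le> m" for m j
  proof -
    have "real j * h m \<le> real m * h m" using that h(1)[of m] by (intro mult_right_mono) auto
    then show "u m j \<le> b" using h(2)[OF that(1)] by (simp add: u_def)
    show "0 \<le> u m j" using ab h(1)[of m] that by (simp add: u_def)
    show "u m j \<le> u m (Suc j)" "u m j < u m (Suc j)" "u m (Suc j) - u m j = h m"
      using h(1)[of m] that by (simp_all add: u_def algebra_simps)
  qed
  have um: "u m m = b" if "m > 0" for m using h(2)[OF that] by (simp add: u_def)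
  have E_ev: "E m \<in> events" if "m > 0" for m
  proof -
    have "{\<omega>\<in>space M. 2 \<le> N (u m (Suc j)) \<omega> - N (u m j) \<omega>} \<in> events" if "j < m" for j
      using u[of m j] u(4)[of m "Suc j"] that \<open>m > 0\<close> ab by (intro ev) auto
    moreover have "{\<omega>\<in>space M. N b \<omega> - N (u m (m - 1)) \<omega> \<noteq> 0} \<in> events"
      using u[of m "m-1"] \<open>m > 0\<close> ab by (intro ev) auto
    ultimately show ?thesis unfolding E_def by auto
  qed
  have E_bound: "prob (E m) \<le> ((\<Lambda> * (b - a))\<^sup>2 + \<Lambda> * (b - a)) / real m" if m: "m > 0" for m
  proof -
    have jev: "{\<omega>\<in>space M. 2 \<le> N (u m (Suc j)) \<omega> - N (u m j) \<omega>} \<in> events" if "j < m" for j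
      using u[of m j] u(4)[of m "Suc j"] that \<open>m > 0\<close> ab by (intro ev) auto
    have lev: "{\<omega>\<in>space M. N b \<omega> - N (u m (m - 1)) \<omega> \<noteq> 0} \<in> events"
      using u[of m "m-1"] \<open>m > 0\<close> ab by (intro ev) auto
    have "prob (E m) \<le> prob (\<Union>j<m. {\<omega>\<in>space M. 2 \<le> N (u m (Suc j)) \<omega> - N (u m j) \<omega>}) +
        prob {\<omega>\<in>space M. N b \<omega> - N (u m (m - 1)) \<omega> \<noteq> 0}"
      unfolding E_def using jev lev by (intro measure_Un_le) auto
    also have "prob (\<Union>j<m. {\<omega>\<in>space M. 2 \<le> N (u m (Suc j)) \<omega> - N (u m j) \<omega>})
        \<le> (\<Sum>j<m. prob {\<omega>\<in>space M. 2 \<le> N (u m (Suc j)) \<omega> - N (u m j) \<omega>})"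
      using jev by (intro finite_measure_subadditive_finite) auto
    also have "\<dots> \<le> (\<Sum>j<m. (\<Lambda> * h m)\<^sup>2)"
    proof (rule sum_mono)
      fix j assume "j \<in> {..<m}"
      then show "prob {\<omega>\<in>space M. 2 \<le> N (u m (Suc j)) \<omega> - N (u m j) \<omega>} \<le> (\<Lambda> * h m)\<^sup>2"
        using two[of "u m j" "u m (Suc j)"] u[of m j] u(4)[of m "Suc j"] m ab by simp
    qed
    also have "\<dots> = (\<Lambda> * (b - a))\<^sup>2 / real m"
      using m by (simp add: h_def power2_eq_square)
    also have "prob {\<omega>\<in>space M. N b \<omega> - N (u m (m - 1)) \<omega> \<noteq> 0} \<le> \<Lambda> * h m"
      using one[of "u m (m-1)" b] u[of m "m-1"] um[OF m] m ab by simp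
    finally show ?thesis by (simp add: h_def add_divide_distrib)
  qed
  have null: "prob (\<Inter>m\<in>{0<..}. E m) = 0"
  proof (rule antisym)
    have "(\<lambda>m. ((\<Lambda> * (b - a))\<^sup>2 + \<Lambda> * (b - a)) / real m) \<longlonglongrightarrow> 0"
      by (rule lim_const_over_n)
    moreover have "\<forall>\<^sub>F m in sequentially. prob (\<Inter>m\<in>{0<..}. E m) \<le> ((\<Lambda> * (b - a))\<^sup>2 + \<Lambda> * (b - a)) / real m"
    proof (rule eventually_sequentiallyI[of 1])
      fix m :: nat assume "1 \<le> m"
      then have "prob (\<Inter>m\<in>{0<..}. E m) \<le> prob (E m)"
        using E_ev by (intro finite_measure_mono) auto
      also have "\<dots> \<le> ((\<Lambda> * (b - a))\<^sup>2 + \<Lambda> * (b - a)) / real m" using E_bound \<open>1 \<le> m\<close> by simp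
      finally show "prob (\<Inter>m\<in>{0<..}. E m) \<le> \<dots>" .
    qed
    ultimately show "prob (\<Inter>m\<in>{0<..}. E m) \<le> 0"
      by (intro tendsto_le[OF _ _ tendsto_const]) auto
  qed simp
  have "(\<Inter>m\<in>{0<..}. E m) \<in> events" using E_ev by (intro sets.countable_INT') auto
  then have "AE \<omega> in M. \<omega> \<notin> (\<Inter>m\<in>{0<..}. E m)"
    using null by (intro AE_not_in) (auto simp: null_sets_def emeasure_eq_measure)
  then show ?thesis
  proof (rule AE_mp, intro AE_I2 impI)
    fix \<omega> assume \<omega>: "\<omega> \<in> space M" "\<omega> \<notin> (\<Inter>m\<in>{0<..}. E m)" "N a \<omega> < N b \<omega>"
    then obtain m where m: "m > 0" "\<omega> \<notin> E m" by auto
    show "\<bar>integral {a..b} (\<lambda>s. (-1::real) ^ N s \<omega>)\<bar> < b - a"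
    proof (rule alternating_integral_unit_jumps[of a b "\<lambda>t. N t \<omega>" "u m" m])
      show "mono_on {a..b} (\<lambda>t. N t \<omega>)"
        using path(1)[OF \<omega>(1)] ab by (auto intro: mono_on_subset)
      have "N (u m (m-1)) \<omega> \<le> N b \<omega>"
        using path(1)[OF \<omega>(1)] u[of m "m-1"] m ab by (auto simp: mono_on_def)
      then show "N (u m (m-1)) \<omega> = N b \<omega>" using m \<omega>(1) by (auto simp: E_def)
      fix j assume "j < m"
      then show "u m j < u m (Suc j)" using u m by simp
      show "N (u m (Suc j)) \<omega> \<le> Suc (N (u m j) \<omega>)"
        using \<open>j < m\<close> m \<omega>(1) by (force simp: E_def)
    qed (use path(2)[OF \<omega>(1)] um m ab \<omega>(3) in \<open>auto simp: u_def\<close>)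
  qed
qed

section \<open>The observations of the telegraph process\<close>

text \<open>The increment of the telegraph process is \<open>V0\<close> times the integral of the alternating sign.  Without
  an event in the interval the sign is constant and the increment has maximal modulus \<open>v \<Delta>\<close>; with an
  event it is almost surely shorter.\<close>

lemma telegraph_switch_obs_AE:
  assumes drv: "telegraph_driver M v (step_intensity lam1 lam2 \<theta>) (real n * \<Delta>) V0 N"
    and pos: "v > 0" "lam1 > 0" "lam2 > 0" "\<Delta> > 0" and i: "i \<in> {1..n}"
  shows "AE \<omega> in M. switch_obs v \<Delta> (\<lambda>t. telegraph V0 N t \<omega>) i =
    of_bool (N (real i * \<Delta>) \<omega> - N (real (i - 1) * \<Delta>) \<omega> \<noteq> 0) / \<Delta>"
proof -
  let ?T = "real n * \<Delta>" 
  define a b where "a = real (i - 1) * \<Delta>" and "b = real i * \<Delta>"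
  have N: "inhom_poisson_process M (step_intensity lam1 lam2 \<theta>) ?T N"
    and V0[measurable]: "V0 \<in> borel_measurable M"
    and half: "measure M {\<omega>\<in>space M. V0 \<omega> = v} = 1/2" "measure M {\<omega>\<in>space M. V0 \<omega> = - v} = 1/2"
    using drv by (auto simp: telegraph_driver_def)
  interpret prob_space M using N by (simp add: inhom_poisson_process_def)
  have ab: "0 \<le> a" "a < b" "b \<le> ?T" "b - a = \<Delta>"
    using i pos by (auto simp: a_def b_def of_nat_diff algebra_simps)
  have "prob ({\<omega>\<in>space M. V0 \<omega> = v} \<union> {\<omega>\<in>space M. V0 \<omega> = - v}) = 1"
    using half pos by (subst finite_measure_Union) auto
  then have "AE \<omega> in M. \<omega> \<in> {\<omega>\<in>space M. V0 \<omega> = v} \<union> {\<omega>\<in>space M. V0 \<omega> = - v}"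
    by (rule AE_prob_1)
  then have speed: "AE \<omega> in M. \<bar>V0 \<omega>\<bar> = v"
    by (rule AE_mp) (use pos in \<open>auto intro!: AE_I2\<close>)
  have "AE \<omega> in M. N a \<omega> < N b \<omega> \<longrightarrow> \<bar>integral {a..b} (\<lambda>s. (-1::real) ^ N s \<omega>)\<bar> < b - a"
  proof (rule poisson_unit_jumps_AE[OF N _ ab(1-3), of "max lam1 lam2"])
    fix s t :: real assume "s \<le> t"
    then show "0 \<le> integral {s..t} (step_intensity lam1 lam2 \<theta>) \<and>
        integral {s..t} (step_intensity lam1 lam2 \<theta>) \<le> max lam1 lam2 * (t - s)"
      using integral_step_intensity_bounds[of lam1 lam2 s t \<theta>] pos by simp
  qed
  with speed show ?thesis
  proof (rule AE_mp[OF AE_conjI], intro AE_I2 impI)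
    fix \<omega> assume \<omega>: "\<omega> \<in> space M"
      and good: "\<bar>V0 \<omega>\<bar> = v \<and> (N a \<omega> < N b \<omega> \<longrightarrow> \<bar>integral {a..b} (\<lambda>s. (-1::real) ^ N s \<omega>)\<bar> < b - a)"
    define I where "I = integral {a..b} (\<lambda>s. (-1::real) ^ N s \<omega>)"
    have mono: "mono_on {0..?T} (\<lambda>t. N t \<omega>)" using N \<omega> by (auto simp: inhom_poisson_process_def)
    have "(\<lambda>s. (-1::real) ^ N s \<omega>) integrable_on {0..b}"
      using ab by (intro minus_one_power_integrable mono_on_subset[OF mono]) auto
    then have "integral {0..a} (\<lambda>s. (-1::real) ^ N s \<omega>) + I = integral {0..b} (\<lambda>s. (-1::real) ^ N s \<omega>)"
      unfolding I_def using ab by (intro Henstock_Kurzweil_Integration.integral_combine) auto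
    then have "telegraph V0 N b \<omega> - telegraph V0 N a \<omega> = V0 \<omega> * I"
      by (simp add: telegraph_def right_diff_distrib[symmetric])
    then have "\<bar>telegraph V0 N b \<omega> - telegraph V0 N a \<omega>\<bar> < v * \<Delta> \<longleftrightarrow> \<bar>I\<bar> < \<Delta>"
      using good pos by (simp add: abs_mult)
    moreover have "\<bar>I\<bar> < \<Delta> \<longleftrightarrow> N b \<omega> - N a \<omega> \<noteq> 0"
    proof (cases "N a \<omega> < N b \<omega>")
      case True
      then show ?thesis using good ab(4) by (simp add: I_def)
    next
      case False
      have const: "N s \<omega> = N a \<omega>" if "s \<in> {a..b}" for s
      proof -
        have "N a \<omega> \<le> N s \<omega>" "N s \<omega> \<le> N b \<omega>"
          using that ab by (auto intro!: mono_onD[OF mono])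
        then show ?thesis using False by simp
      qed
      have "I = integral {a..b} (\<lambda>s. (-1::real) ^ N a \<omega>)"
        unfolding I_def by (rule integral_cong) (simp only: const)
      then have "\<bar>I\<bar> = \<Delta>" using ab by (simp add: abs_mult power_abs)
      then show ?thesis using False by simp
    qed
    ultimately show "switch_obs v \<Delta> (\<lambda>t. telegraph V0 N t \<omega>) i =
        of_bool (N (real i * \<Delta>) \<omega> - N (real (i - 1) * \<Delta>) \<omega> \<noteq> 0) / \<Delta>"
      by (simp add: switch_obs_def a_def b_def)
  qed
qed

lemma (in prob_space) bernoulli_moments:
  assumes A: "A \<in> events"
  shows "expectation (\<lambda>\<omega>. indicator A \<omega> / \<Delta> - prob A / \<Delta>) = 0"
    and "expectation (\<lambda>\<omega>. (indicator A \<omega> / \<Delta> - prob A / \<Delta>)\<^sup>2) \<le> prob A / \<Delta>\<^sup>2"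
proof -
  have int: "integrable M (\<lambda>\<omega>. indicator A \<omega> :: real)" using A by (simp add: integrable_real_indicator emeasure_eq_measure)
  then show "expectation (\<lambda>\<omega>. indicator A \<omega> / \<Delta> - prob A / \<Delta>) = 0"
    using A by (simp add: prob_space)
  have sq: "(indicator A \<omega> / \<Delta> - prob A / \<Delta>)\<^sup>2 = ((1 - 2 * prob A) * indicator A \<omega> + (prob A)\<^sup>2) / \<Delta>\<^sup>2" for \<omega>
  proof -
    have "(indicator A \<omega> / \<Delta> - prob A / \<Delta>)\<^sup>2 = (indicator A \<omega> - prob A)\<^sup>2 / \<Delta>\<^sup>2"
      by (simp only: diff_divide_distrib[symmetric] power_divide)
    also have "(indicator A \<omega> - prob A)\<^sup>2 = (1 - 2 * prob A) * indicator A \<omega> + (prob A)\<^sup>2"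
      by (cases "\<omega> \<in> A") (simp_all add: power2_diff)
    finally show ?thesis .
  qed
  have "expectation (\<lambda>\<omega>. (indicator A \<omega> / \<Delta> - prob A / \<Delta>)\<^sup>2) = ((1 - 2 * prob A) * prob A + (prob A)\<^sup>2) / \<Delta>\<^sup>2"
    unfolding sq using int A by (simp add: prob_space)
  also have "(1 - 2 * prob A) * prob A + (prob A)\<^sup>2 = prob A - (prob A)\<^sup>2"
    by (simp add: power2_eq_square left_diff_distrib)
  also have "(prob A - (prob A)\<^sup>2) / \<Delta>\<^sup>2 \<le> prob A / \<Delta>\<^sup>2" by (rule divide_right_mono) simp_all
  finally show "expectation (\<lambda>\<omega>. (indicator A \<omega> / \<Delta> - prob A / \<Delta>)\<^sup>2) \<le> prob A / \<Delta>\<^sup>2" .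
qed

text \<open>The deterministic error bound holds outside two events, on which the normalised partial sums of the
  noise from the left or from the right exceed \<open>a\<close>.  The sums from the right are sums from the left
  of the reversed sequence, so one maximal inequality serves for both; the factor \<open>2\<close> is their union.\<close>

lemma telegraph_change_point_tail_bound:
  assumes drv: "telegraph_driver M v (step_intensity lam1 lam2 (real k0 * \<Delta>)) (real n * \<Delta>) V0 N"
    and pos: "v > 0" "lam1 > 0" "lam2 > 0" "\<Delta> > 0"
    and k0: "1 \<le> k0" "k0 < n"
    and \<kappa>: "0 < \<kappa>" "\<kappa> \<le> real k0 / real n" "\<kappa> \<le> 1 - real k0 / real n"
    and khat: "ls_change_point_estimator M n (\<lambda>i \<omega>. switch_obs v \<Delta> (\<lambda>t. telegraph V0 N t \<omega>) i) khat"
    and a: "a > 0"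
  shows "measure M {\<omega>\<in>space M. 8 * a / (\<kappa> * sqrt (real n)) <
      \<bar>switch_rate lam2 \<Delta> - switch_rate lam1 \<Delta>\<bar> * \<bar>real (khat \<omega>) / real n - real k0 / real n\<bar>}
    \<le> 2 * (max lam1 lam2 / \<Delta> * (1 + ln (real n)) / a\<^sup>2)"
proof -
  let ?T = "real n * \<Delta>" and ?lam = "step_intensity lam1 lam2 (real k0 * \<Delta>)"
  define g where "g = step_mean k0 (switch_rate lam1 \<Delta>) (switch_rate lam2 \<Delta>)"
  define \<Lambda> where "\<Lambda> = max lam1 lam2"
  have N: "inhom_poisson_process M ?lam ?T N" using drv by (simp add: telegraph_driver_def)
  interpret prob_space M using N by (simp add: inhom_poisson_process_def)
  define J where "J i = {\<omega>\<in>space M. N (real i * \<Delta>) \<omega> - N (real (i - 1) * \<Delta>) \<omega> \<noteq> 0}" for i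
  define E where "E i \<omega> = of_bool (N (real i * \<Delta>) \<omega> - N (real (i - 1) * \<Delta>) \<omega> \<noteq> 0) / \<Delta> - g i" for i \<omega>
  have meas: "N t \<in> measurable M (count_space UNIV)" if "0 \<le> t" "t \<le> ?T" for t
    using N that by (auto simp: inhom_poisson_process_def)
  have grid: "0 \<le> real (i - 1) * \<Delta>" "real (i - 1) * \<Delta> \<le> real i * \<Delta>" "real i * \<Delta> \<le> ?T"
      "real i * \<Delta> - real (i - 1) * \<Delta> = \<Delta>" if "i \<in> {1..n}" for i
    using that pos by (auto simp: of_nat_diff algebra_simps)
  have J_ev: "J i \<in> events" if "i \<in> {1..n}" for i
  proof -
    have [measurable]: "N (real i * \<Delta>) \<in> measurable M (count_space UNIV)"
      "N (real (i - 1) * \<Delta>) \<in> measurable M (count_space UNIV)"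
      using grid[OF that] by (auto intro!: meas)
    show ?thesis unfolding J_def by measurable
  qed
  have J_prob: "prob (J i) / \<Delta> = g i" "prob (J i) \<le> \<Lambda> * \<Delta>" if i: "i \<in> {1..n}" for i
  proof -
    define x where "x = integral {real (i - 1) * \<Delta>..real i * \<Delta>} ?lam"
    have ev: "{\<omega>\<in>space M. N (real i * \<Delta>) \<omega> - N (real (i - 1) * \<Delta>) \<omega> = 0} \<in> events"
    proof -
      have "{\<omega>\<in>space M. N (real i * \<Delta>) \<omega> - N (real (i - 1) * \<Delta>) \<omega> = 0} = space M - J i"
        by (auto simp: J_def)
      then show ?thesis using J_ev[OF i] by auto
    qed
    have "prob {\<omega>\<in>space M. N (real i * \<Delta>) \<omega> - N (real (i - 1) * \<Delta>) \<omega> = 0}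
        = exp (- x) * x ^ 0 / fact 0"
      using N grid[OF i] unfolding inhom_poisson_process_def x_def by blast
    then have p: "prob (J i) = 1 - exp (- x)"
      unfolding J_def using prob_neg[OF ev] by simp
    have x: "x = (if i \<le> k0 then lam1 else lam2) * \<Delta>"
    proof (cases "i \<le> k0")
      case True
      then have "real i * \<Delta> \<le> real k0 * \<Delta>" using pos by (intro mult_right_mono) auto
      then show ?thesis
        using integral_step_intensity_left[OF grid(2)[OF i]] grid(4)[OF i] True by (simp add: x_def)
    next
      case False
      then have "real k0 * \<Delta> \<le> real (i - 1) * \<Delta>" using pos by (intro mult_right_mono) auto
      then show ?thesis
        using integral_step_intensity_right[OF grid(2)[OF i]] grid(4)[OF i] False by (simp add: x_def)
    qed
    show "prob (J i) / \<Delta> = g i"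
      unfolding p x g_def step_mean_def switch_rate_def by simp
    have "1 - exp (- x) \<le> x" using exp_ge_add_one_self[of "-x"] by simp
    also have "\<dots> \<le> \<Lambda> * \<Delta>" unfolding x \<Lambda>_def using pos by (intro mult_right_mono) auto
    finally show "prob (J i) \<le> \<Lambda> * \<Delta>" by (simp add: p)
  qed
  have E_indep: "indep_vars (\<lambda>_. borel) E {1..n}"
  proof -
    have grid_mono: "mono_on {..n} (\<lambda>i. real i * \<Delta>)"
      using pos by (auto simp: mono_on_def intro!: mult_right_mono)
    have in_range: "\<forall>i\<le>n. real i * \<Delta> \<in> {0..?T}"
      using pos by (auto intro!: mult_right_mono)
    have "indep_vars (\<lambda>_. count_space UNIV) (\<lambda>i \<omega>. N (u (Suc i)) \<omega> - N (u i) \<omega>) {..<m}"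
      if "\<forall>i\<le>m. u i \<in> {0..?T}" "mono_on {..m} u" for m u
      using N that unfolding inhom_poisson_process_def by blast
    from this[OF in_range grid_mono]
    have "indep_vars (\<lambda>_. count_space UNIV)
        (\<lambda>i \<omega>. N (real (Suc i) * \<Delta>) \<omega> - N (real i * \<Delta>) \<omega>) {..<n}" .
    then have "indep_vars (\<lambda>_. count_space UNIV)
        (\<lambda>i \<omega>. N (real (Suc (i - 1)) * \<Delta>) \<omega> - N (real (i - 1) * \<Delta>) \<omega>) {1..n}"
      by (rule indep_vars_reindex_inj) (auto simp: inj_on_def)
    then have "indep_vars (\<lambda>_. borel) (\<lambda>i \<omega>. (\<lambda>d::nat. of_bool (d \<noteq> 0) / \<Delta> - g i)
        (N (real (Suc (i - 1)) * \<Delta>) \<omega> - N (real (i - 1) * \<Delta>) \<omega>)) {1..n}"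
      by (rule indep_vars_compose2) auto
    then show ?thesis
      by (rule indep_vars_cong[THEN iffD1, rotated -1]) (auto simp: E_def[abs_def])
  qed
  then have E_rv: "E i \<in> borel_measurable M" if "i \<in> {1..n}" for i
    using that by (auto simp: indep_vars_def)
  have E_bound: "\<bar>E i \<omega>\<bar> \<le> 1 / \<Delta> + \<bar>switch_rate lam1 \<Delta>\<bar> + \<bar>switch_rate lam2 \<Delta>\<bar>" for i \<omega>
  proof -
    have "\<bar>of_bool P / \<Delta>\<bar> \<le> 1 / \<Delta>" for P using pos by simp
    note this[of "N (real i * \<Delta>) \<omega> - N (real (i - 1) * \<Delta>) \<omega> \<noteq> 0"]
    moreover have "\<bar>g i\<bar> \<le> \<bar>switch_rate lam1 \<Delta>\<bar> + \<bar>switch_rate lam2 \<Delta>\<bar>" by (auto simp: g_def step_mean_def)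
    ultimately show ?thesis unfolding E_def by linarith
  qed
  have E_centred: "expectation (E i) = 0" and E_var: "expectation (\<lambda>\<omega>. (E i \<omega>)\<^sup>2) \<le> \<Lambda> / \<Delta>"
    if i: "i \<in> {1..n}" for i
  proof -
    have E_ind: "E i \<omega> = indicator (J i) \<omega> / \<Delta> - prob (J i) / \<Delta>" if "\<omega> \<in> space M" for \<omega>
      using that J_prob(1)[OF i] by (simp add: E_def J_def indicator_def)
    show "expectation (E i) = 0"
      using bernoulli_moments(1)[OF J_ev[OF i], of \<Delta>] E_ind
      by (simp cong: Bochner_Integration.integral_cong)
    have "expectation (\<lambda>\<omega>. (E i \<omega>)\<^sup>2) \<le> prob (J i) / \<Delta>\<^sup>2"
      using bernoulli_moments(2)[OF J_ev[OF i], of \<Delta>] E_ind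
      by (simp cong: Bochner_Integration.integral_cong)
    also have "\<dots> \<le> (\<Lambda> * \<Delta>) / \<Delta>\<^sup>2" using J_prob(2)[OF i] by (intro divide_right_mono) auto
    finally show "expectation (\<lambda>\<omega>. (E i \<omega>)\<^sup>2) \<le> \<Lambda> / \<Delta>" using pos by (simp add: power2_eq_square)
  qed
  \<comment> \<open>\<open>H\<close>: large normalised sums from the head, \<open>R\<close>: from the tail, by reversing the indices.\<close>
  define H where "H = {\<omega>\<in>space M. \<exists>k\<in>{1..n}. a * sqrt (real k) \<le> \<bar>\<Sum>i=1..k. E i \<omega>\<bar>}"
  define R where "R = {\<omega>\<in>space M. \<exists>k\<in>{1..n}. a * sqrt (real k) \<le> \<bar>\<Sum>i=1..k. E (n + 1 - i) \<omega>\<bar>}"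
  have n: "n \<ge> 1" using k0 by simp
  have H_prob: "prob H \<le> \<Lambda> / \<Delta> * (1 + ln (real n)) / a\<^sup>2"
    unfolding H_def
    by (rule sqrt_normalised_maximal_inequality[where X = E, OF E_indep E_bound E_centred E_var n a])
  have R_prob: "prob R \<le> \<Lambda> / \<Delta> * (1 + ln (real n)) / a\<^sup>2"
    unfolding R_def
  proof (rule sqrt_normalised_maximal_inequality[where X = "\<lambda>i. E (n + 1 - i)", OF _ E_bound _ _ n a])
    show "indep_vars (\<lambda>_. borel) (\<lambda>i. E (n + 1 - i)) {1..n}"
      by (rule indep_vars_reindex_inj[OF E_indep, of "\<lambda>i. n + 1 - i"]) (auto simp: inj_on_def)
    fix i assume "i \<in> {1..n}"
    then have i: "n + 1 - i \<in> {1..n}" by auto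
    show "expectation (E (n + 1 - i)) = 0" "expectation (\<lambda>\<omega>. (E (n + 1 - i) \<omega>)\<^sup>2) \<le> \<Lambda> / \<Delta>"
      by (rule E_centred[OF i], rule E_var[OF i])
  qed
  have HR: "H \<in> events" "R \<in> events"
  proof -
    have [measurable]: "(\<lambda>\<omega>. \<Sum>i=1..k. E i \<omega>) \<in> borel_measurable M" if "k \<in> {1..n}" for k
      using that by (intro borel_measurable_sum E_rv) auto
    show "H \<in> events" unfolding H_def by measurable
    have [measurable]: "(\<lambda>\<omega>. \<Sum>i=1..k. E (n + 1 - i) \<omega>) \<in> borel_measurable M" if "k \<in> {1..n}" for k
      using that by (intro borel_measurable_sum E_rv) auto
    show "R \<in> events" unfolding R_def by measurable
  qed
  let ?Y = "\<lambda>i \<omega>. switch_obs v \<Delta> (\<lambda>t. telegraph V0 N t \<omega>) i"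
  let ?obs = "\<lambda>\<omega>. \<forall>i\<in>{1..n}. ?Y i \<omega> = of_bool (N (real i * \<Delta>) \<omega> - N (real (i - 1) * \<Delta>) \<omega> \<noteq> 0) / \<Delta>"
  let ?err = "\<lambda>\<omega>. \<bar>switch_rate lam2 \<Delta> - switch_rate lam1 \<Delta>\<bar> * \<bar>real (khat \<omega>) / real n - real k0 / real n\<bar>"
  have AE_obs: "AE \<omega> in M. ?obs \<omega>"
    using telegraph_switch_obs_AE[OF drv pos] by (intro AE_finite_allI) auto
  have good: "?err \<omega> \<le> 8 * a / (\<kappa> * sqrt (real n))"
    if \<omega>: "\<omega> \<in> space M" and obs: "?obs \<omega>" and notin: "\<omega> \<notin> H \<union> R" for \<omega>
  proof -
    have noise: "?Y i \<omega> - g i = E i \<omega>" if "i \<in> {1..n}" for i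
      using obs that by (simp add: E_def)
    show ?thesis
    proof (rule ls_argmin_error_bound[OF _ k0 \<kappa>])
      show "is_arg_min (ls_criterion n (\<lambda>i. ?Y i \<omega>)) (\<lambda>k. k \<in> {1..n-1}) (khat \<omega>)"
        using khat \<omega> by (simp add: ls_change_point_estimator_def)
    next
      fix j assume j: "j \<in> {1..n}"
      then have "(\<Sum>i=1..j. ?Y i \<omega> - g i) = (\<Sum>i=1..j. E i \<omega>)"
        by (intro sum.cong noise) auto
      then show "\<bar>\<Sum>i=1..j. ?Y i \<omega> - step_mean k0 (switch_rate lam1 \<Delta>) (switch_rate lam2 \<Delta>) i\<bar> \<le> a * sqrt (real j)"
        using notin \<omega> j by (auto simp: H_def g_def not_le less_imp_le)
    next
      fix j assume j: "j \<in> {1..<n}"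
      then have "(\<Sum>i=j+1..n. ?Y i \<omega> - g i) = (\<Sum>i=j+1..n. E i \<omega>)"
        by (intro sum.cong noise) auto
      also have "\<dots> = (\<Sum>i=1..n-j. E (n + 1 - i) \<omega>)"
        using j by (intro sum.reindex_bij_witness[of _ "\<lambda>i. n + 1 - i" "\<lambda>i. n + 1 - i"]) auto
      finally have eq: "(\<Sum>i=j+1..n. ?Y i \<omega> - g i) = (\<Sum>i=1..n-j. E (n + 1 - i) \<omega>)" .
      have "n - j \<in> {1..n}" using j by auto
      then have "\<not> a * sqrt (real (n - j)) \<le> \<bar>\<Sum>i=1..n-j. E (n + 1 - i) \<omega>\<bar>"
        using notin \<omega> unfolding R_def by blast
      then have small: "\<bar>\<Sum>i=j+1..n. ?Y i \<omega> - g i\<bar> \<le> a * sqrt (real (n - j))"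
        unfolding eq by linarith
      show "\<bar>\<Sum>i=j+1..n. ?Y i \<omega> - step_mean k0 (switch_rate lam1 \<Delta>) (switch_rate lam2 \<Delta>) i\<bar> \<le> a * sqrt (real (n - j))"
        using small unfolding g_def .
    qed
  qed
  have AE_sub: "AE \<omega> in M. \<omega> \<in> {\<omega>\<in>space M. 8 * a / (\<kappa> * sqrt (real n)) < ?err \<omega>} \<longrightarrow> \<omega> \<in> H \<union> R"
  proof (rule AE_mp[OF AE_obs AE_I2], intro impI, rule ccontr)
    fix \<omega> assume "\<omega> \<in> space M" "?obs \<omega>" "\<omega> \<notin> H \<union> R"
    then have "?err \<omega> \<le> 8 * a / (\<kappa> * sqrt (real n))" by (rule good)
    moreover assume "\<omega> \<in> {\<omega>\<in>space M. 8 * a / (\<kappa> * sqrt (real n)) < ?err \<omega>}"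
    ultimately show False by simp
  qed
  have "prob {\<omega>\<in>space M. 8 * a / (\<kappa> * sqrt (real n)) < ?err \<omega>} \<le> prob (H \<union> R)"
    using HR by (intro finite_measure_mono_AE[OF AE_sub]) auto
  also have "\<dots> \<le> prob H + prob R" by (rule measure_Un_le) (fact HR)+
  finally show ?thesis using H_prob R_prob by (simp add: \<Lambda>_def)
qed


lemma switch_rate_bounds:
  assumes "0 \<le> lam" "0 < \<Delta>"
  shows "0 \<le> switch_rate lam \<Delta>" "switch_rate lam \<Delta> \<le> lam"
proof -
  have "1 + - (lam * \<Delta>) \<le> exp (- (lam * \<Delta>))" by (rule exp_ge_add_one_self)
  then have "1 - exp (- (lam * \<Delta>)) \<le> lam * \<Delta>" by linarith
  then show "switch_rate lam \<Delta> \<le> lam" using assms by (simp add: switch_rate_def pos_divide_le_eq)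
  show "0 \<le> switch_rate lam \<Delta>" using assms by (simp add: switch_rate_def)
qed

lemma switch_rate_inj:
  assumes "0 < \<Delta>" "lam1 \<noteq> lam2"
  shows "switch_rate lam1 \<Delta> \<noteq> switch_rate lam2 \<Delta>"
  using assms by (simp add: switch_rate_def)

section \<open>The rate of the estimator\<close>

theorem theorem3p1:
  fixes v lam1 lam2 \<tau> :: real
    and \<Delta> :: "nat \<Rightarrow> real"
    and M :: "nat \<Rightarrow> 'a measure"
    and V0 :: "nat \<Rightarrow> 'a \<Rightarrow> real"
    and N :: "nat \<Rightarrow> real \<Rightarrow> 'a \<Rightarrow> nat"
    and k0 :: "nat \<Rightarrow> nat"
    and Y :: "nat \<Rightarrow> nat \<Rightarrow> 'a \<Rightarrow> real"
    and khat :: "nat \<Rightarrow> 'a \<Rightarrow> nat"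
  assumes v: "v > 0"
    and lam: "lam1 > 0" "lam2 > 0" "lam1 \<noteq> lam2"
    and tau: "0 < \<tau>" "\<tau> < 1"
    and Delta_pos: "\<And>n. n \<ge> 2 \<Longrightarrow> \<Delta> n > 0"
    and Delta_lim: "\<Delta> \<longlonglongrightarrow> 0"
    and T_lim: "filterlim (\<lambda>n. real n * \<Delta> n) at_top sequentially"
    and k0: "\<And>n. k0 n = nat \<lfloor>real n * \<tau>\<rfloor>"
    and process: "\<And>n. n \<ge> 2 \<Longrightarrow>
      telegraph_driver (M n) v (step_intensity lam1 lam2 (real (k0 n) * \<Delta> n))
        (real n * \<Delta> n) (V0 n) (N n)"
    and Y: "\<And>n i \<omega>. Y n i \<omega> = switch_obs v (\<Delta> n) (\<lambda>t. telegraph (V0 n) (N n) t \<omega>) i"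
    and khat: "\<And>n. n \<ge> 2 \<Longrightarrow> ls_change_point_estimator (M n) n (Y n) (khat n)"
  shows "\<exists>Z. bigO_prob M Z (\<lambda>n. sqrt (ln (real n))) \<and>
    (\<forall>n\<ge>2. \<forall>\<omega>\<in>space (M n).
       \<bar>real (khat n \<omega>) / real n - \<tau>\<bar> =
         (real n * \<Delta> n) powr (-1/2) *
         inverse (switch_rate lam2 (\<Delta> n) - switch_rate lam1 (\<Delta> n)) * Z n \<omega>)"
proof -
  define g where "g n = switch_rate lam2 (\<Delta> n) - switch_rate lam1 (\<Delta> n)" for n
  define err where "err n \<omega> = \<bar>real (khat n \<omega>) / real n - \<tau>\<bar>" for n \<omega>
  define Z where "Z n \<omega> = (if n < 2 then 0 else sqrt (real n * \<Delta> n) * g n * err n \<omega>)" for n \<omega>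
  define \<Lambda> where "\<Lambda> = max lam1 lam2"
  define \<kappa> where "\<kappa> = min (\<tau> / 2) (1 - \<tau>)"
  have \<Lambda>: "\<Lambda> > 0" and \<kappa>: "\<kappa> > 0" using lam tau by (auto simp: \<Lambda>_def \<kappa>_def)
  have g_nz: "g n \<noteq> 0" and g_le: "\<bar>g n\<bar> \<le> \<Lambda>" if "n \<ge> 2" for n
  proof -
    note d = Delta_pos[OF that]
    show "g n \<noteq> 0" using switch_rate_inj[OF d lam(3)] by (simp add: g_def)
    show "\<bar>g n\<bar> \<le> \<Lambda>"
      using switch_rate_bounds[of lam1, OF _ d] switch_rate_bounds[of lam2, OF _ d] lam
      by (auto simp: g_def \<Lambda>_def)
  qed
  have khat_meas: "khat n \<in> measurable (M n) (count_space UNIV)" if "n \<ge> 2" for n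
    using khat[OF that] by (simp add: ls_change_point_estimator_def)
  have "Z n \<in> borel_measurable (M n)" for n
  proof (cases "n < 2")
    case False
    then have [measurable]: "khat n \<in> measurable (M n) (count_space UNIV)" using khat_meas by simp
    show ?thesis unfolding Z_def err_def by measurable
  qed (simp add: Z_def[abs_def])
  moreover have "\<exists>C>0. \<forall>\<^sub>F n in sequentially.
      measure (M n) {\<omega>\<in>space (M n). \<bar>Z n \<omega>\<bar> > C * sqrt (ln (real n))} < \<epsilon>" if \<epsilon>: "\<epsilon> > 0" for \<epsilon>
  proof (intro exI conjI)
    \<comment> \<open>For this \<open>K\<close> the tail bound at level \<open>a = K * sqrt (ln n / \<Delta> n)\<close> is at most
      \<open>4 * \<Lambda> / K\<^sup>2 = \<epsilon> / 2\<close>; the summand \<open>\<Lambda>\<close> of \<open>C\<close> absorbs the rounding of \<open>n * \<tau>\<close> to \<open>k0 n\<close>.\<close>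
    define K where "K = sqrt (8 * \<Lambda> / \<epsilon>)"
    have K: "K > 0" "K\<^sup>2 = 8 * \<Lambda> / \<epsilon>" using \<Lambda> \<epsilon> by (auto simp: K_def)
    define C where "C = 8 * K / \<kappa> + \<Lambda>"
    show "C > 0" using K(1) \<kappa> \<Lambda> by (simp add: C_def add_pos_pos)
    have "\<forall>\<^sub>F n in sequentially. \<Delta> n < 1"
      using order_tendstoD(2)[OF Delta_lim, of 1] by simp
    moreover have "\<forall>\<^sub>F n in sequentially. 2 / \<tau> \<le> real n"
      using filterlim_real_sequentially by (auto simp: filterlim_at_top)
    moreover have "\<forall>\<^sub>F n in sequentially. 3 \<le> n" by (rule eventually_ge_at_top)
    ultimately show "\<forall>\<^sub>F n in sequentially.
      measure (M n) {\<omega>\<in>space (M n). \<bar>Z n \<omega>\<bar> > C * sqrt (ln (real n))} < \<epsilon>"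
    proof eventually_elim
      case (elim n)
      have n: "n \<ge> 2" "real n > 0" using elim by auto
      note d = Delta_pos[OF n(1)]
      have ln1: "ln (real n) \<ge> 1"
        using elim e_less_272 by (subst ln_ge_iff) auto
      define t where "t = real (k0 n) / real n"
      have "2 \<le> real n * \<tau>" using elim tau by (simp add: field_simps)
      have k0_bounds: "real n * \<tau> - 1 < real (k0 n)" "real (k0 n) \<le> real n * \<tau>"
        using k0[of n] \<open>2 \<le> real n * \<tau>\<close> by linarith+
      have "real n * \<tau> < real n" using tau n by simp
      then have k0_range: "1 \<le> k0 n" "k0 n < n" using k0_bounds \<open>2 \<le> real n * \<tau>\<close> by linarith+
      have t_le: "t \<le> \<tau>" "\<tau> / 2 \<le> t"
        using k0_bounds n \<open>2 \<le> real n * \<tau>\<close> by (auto simp: t_def field_simps)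
      have "\<tau> - t = (real n * \<tau> - real (k0 n)) / real n" using n by (simp add: t_def field_simps)
      also have "\<dots> \<le> 1 / real n" using k0_bounds n by (intro divide_right_mono) auto
      finally have t_ge: "\<tau> - t \<le> 1 / real n" .
      define a where "a = K * sqrt (ln (real n) / \<Delta> n)"
      have a: "a > 0" using K(1) ln1 d by (simp add: a_def)
      interpret prob_space "M n"
        using process[OF n(1)] by (simp add: telegraph_driver_def inhom_poisson_process_def)
      let ?B = "{\<omega>\<in>space (M n). 8 * a / (\<kappa> * sqrt (real n)) < \<bar>g n\<bar> * \<bar>real (khat n \<omega>) / real n - t\<bar>}"
      have "(\<lambda>i \<omega>. switch_obs v (\<Delta> n) (\<lambda>t. telegraph (V0 n) (N n) t \<omega>) i) = Y n"
        using Y by (simp add: fun_eq_iff)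
      then have "prob ?B \<le> 2 * (\<Lambda> / \<Delta> n * (1 + ln (real n)) / a\<^sup>2)"
        unfolding g_def \<Lambda>_def t_def
        using tau t_le khat[OF n(1)]
        by (intro telegraph_change_point_tail_bound[OF process[OF n(1)] v lam(1,2) d k0_range \<kappa> _ _ _ a])
           (auto simp: \<kappa>_def t_def[symmetric])
      also have "\<dots> \<le> 2 * (\<Lambda> / \<Delta> n * (2 * ln (real n)) / a\<^sup>2)"
        using ln1 \<Lambda> d by (intro mult_left_mono divide_right_mono) auto
      also have "\<dots> = 4 * \<Lambda> / K\<^sup>2"
        using ln1 d by (simp add: a_def power_mult_distrib)
      also have "\<dots> = \<epsilon> / 2" using \<Lambda> \<epsilon> by (simp add: K(2))
      finally have "prob ?B < \<epsilon>" using \<epsilon> by simp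
      moreover have "prob {\<omega>\<in>space (M n). \<bar>Z n \<omega>\<bar> > C * sqrt (ln (real n))} \<le> prob ?B"
      proof (rule finite_measure_mono)
        have [measurable]: "khat n \<in> measurable (M n) (count_space UNIV)" using khat_meas n by simp
        show "?B \<in> events" by measurable
        show "{\<omega>\<in>space (M n). \<bar>Z n \<omega>\<bar> > C * sqrt (ln (real n))} \<subseteq> ?B"
        proof safe
          fix \<omega> assume big: "\<bar>Z n \<omega>\<bar> > C * sqrt (ln (real n))"
          define e where "e = \<bar>real (khat n \<omega>) / real n - t\<bar>"
          define r where "r = sqrt (real n * \<Delta> n)"
          have r: "r > 0" using n d by (simp add: r_def)
          have "err n \<omega> \<le> e + 1 / real n" using t_le(1) t_ge unfolding err_def e_def by linarith
          then have "r * \<bar>g n\<bar> * err n \<omega> \<le> r * \<bar>g n\<bar> * (e + 1 / real n)"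
            using r by (intro mult_left_mono) auto
          also have "\<dots> = r * (\<bar>g n\<bar> * e) + \<bar>g n\<bar> * (r / real n)"
            by (simp add: algebra_simps)
          also have "\<bar>g n\<bar> * (r / real n) \<le> \<Lambda> * 1"
          proof (intro mult_mono g_le[OF n(1)])
            have "r \<le> sqrt (real n * real n)"
              unfolding r_def using elim n by (intro real_sqrt_le_mono mult_left_mono) auto
            then show "r / real n \<le> 1" using n by simp
          qed (use \<Lambda> r in auto)
          also have "\<Lambda> * 1 \<le> \<Lambda> * sqrt (ln (real n))"
            using \<Lambda> ln1 by (intro mult_left_mono) auto
          finally have "\<bar>Z n \<omega>\<bar> \<le> r * (\<bar>g n\<bar> * e) + \<Lambda> * sqrt (ln (real n))"
            using n r by (simp add: Z_def abs_mult r_def[symmetric]) (simp add: err_def)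
          with big have "8 * K / \<kappa> * sqrt (ln (real n)) < r * (\<bar>g n\<bar> * e)"
            by (simp add: C_def distrib_right)
          moreover have "8 * K / \<kappa> * sqrt (ln (real n)) = r * (8 * a / (\<kappa> * sqrt (real n)))"
            using n d \<kappa> by (simp add: r_def a_def real_sqrt_mult real_sqrt_divide)
          ultimately have "r * (8 * a / (\<kappa> * sqrt (real n))) < r * (\<bar>g n\<bar> * e)" by linarith
          then show "8 * a / (\<kappa> * sqrt (real n)) < \<bar>g n\<bar> * \<bar>real (khat n \<omega>) / real n - t\<bar>"
            by (simp only: mult_less_cancel_left_pos[OF r] e_def)
        qed
      qed
      ultimately show ?case by simp
    qed
  qed
  ultimately have "bigO_prob M Z (\<lambda>n. sqrt (ln (real n)))"
    unfolding bigO_prob_def by blast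
  moreover have "\<bar>real (khat n \<omega>) / real n - \<tau>\<bar> = (real n * \<Delta> n) powr (-1/2) *
      inverse (switch_rate lam2 (\<Delta> n) - switch_rate lam1 (\<Delta> n)) * Z n \<omega>" if n: "n \<ge> 2" for n \<omega>
  proof -
    have T: "real n * \<Delta> n > 0" using n Delta_pos[OF n] by simp
    define r where "r = sqrt (real n * \<Delta> n)"
    have r: "r \<noteq> 0" "(real n * \<Delta> n) powr (-1/2) = inverse r"
      using n Delta_pos[OF n] T powr_minus[of "real n * \<Delta> n" "1/2"] by (simp_all add: r_def powr_half_sqrt)
    have "inverse r * inverse (g n) * (r * g n * err n \<omega>) = err n \<omega>"
      using r(1) g_nz[OF n] by (simp add: field_simps)
    then show ?thesis
      unfolding r(2) g_def[symmetric] using n by (simp add: Z_def err_def r_def)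
  qed
  ultimately show ?thesis by blast
qed

end
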